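(* Let $\nu_1(u,v),\nu_2(u,v),\gamma_1(u,v),\gamma_2(u,v)$, $(u,v)\in\mathcal D$, be given functions satisfying: 1) $\nu_1-\nu_2>0$, $\gamma_1(\nu_1)_v>0$, $\gamma_2(\nu_2)_u>0$; 2.1) $\displaystyle\left(\ln\frac{(\nu_1)_v}{\gamma_1}\right)_u=\frac{(\nu_1)_u}{\nu_1-\nu_2}$ and $\displaystyle\left(\ln\frac{(\nu_2)_u}{\gamma_2}\right)_v=-\frac{(\nu_2)_v}{\nu_1-\nu_2}$; 2.2) $\displaystyle\frac{\nu_1-\nu_2}{2}\left(\frac{(\gamma_1^2)_v}{(\nu_1)_v}-\frac{(\gamma_2^2)_u}{(\nu_2)_u}\right)-(\gamma_1^2+\gamma_2^2)=\nu_1\nu_2$. Then, for any $(u_0,v_0)\in\mathcal D$, there exists a strongly regular surface $x=x(u,v)$ defined on a neighborhood $\mathcal D_0\subset\mathcal D$ of $(u_0,v_0)$, for which $(u,v)$ are principal parameters and whose invariants are the prescribed functions $\nu_1,\nu_2,\gamma_1,\gamma_2$; this surface is unique up to a motion.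
   Context: For a surface $x=x(u,v)$ in $\mathbb R^3$ without umbilical points parameterized by principal parameters ($F=M=0$, where $E,F,G$, $L,M,N$ are the coefficients of the first and second fundamental forms), the invariants are the principal curvatures $\nu_1=L/E$, $\nu_2=N/G$ and the principal geodesic curvatures $\gamma_1=-\frac{E_v}{2E\sqrt G}$, $\gamma_2=\frac{G_u}{2G\sqrt E}$, computed with respect to the frame $X=x_u/\sqrt E$, $Y=x_v/\sqrt G$ and unit normal $l$ such that $(X,Y,l)$ is right oriented. The surface is strongly regular if $(\nu_1-\nu_2)\gamma_1\gamma_2\neq0$ everywhere; for strongly regular surfaces the frame is specified so that $\nu_1-\nu_2>0$. *)

theory Defs
  imports "HOL-Analysis.Analysis" "HOL-Analysis.Cross3"
begin

definition pu :: "(real \<times> real \<Rightarrow> 'b::real_normed_vector) \<Rightarrow> real \<times> real \<Rightarrow> 'b" where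
  "pu f p = vector_derivative (\<lambda>t. f (t, snd p)) (at (fst p))"

definition pv :: "(real \<times> real \<Rightarrow> 'b::real_normed_vector) \<Rightarrow> real \<times> real \<Rightarrow> 'b" where
  "pv f p = vector_derivative (\<lambda>t. f (fst p, t)) (at (snd p))"

fun iter_partial :: "bool list \<Rightarrow> (real \<times> real \<Rightarrow> 'b::real_normed_vector) \<Rightarrow> real \<times> real \<Rightarrow> 'b" where
  "iter_partial [] f = f"
| "iter_partial (b # bs) f = (if b then pu else pv) (iter_partial bs f)"

definition smooth_on :: "(real \<times> real) set \<Rightarrow> (real \<times> real \<Rightarrow> 'b::real_normed_vector) \<Rightarrow> bool" where
  "smooth_on D f \<longleftrightarrow> (\<forall>ds. \<forall>p\<in>D. iter_partial ds f differentiable (at p))"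

type_synonym surf = "real \<times> real \<Rightarrow> real^3"

definition E_fun :: "surf \<Rightarrow> real \<times> real \<Rightarrow> real" where "E_fun x p = pu x p \<bullet> pu x p"
definition F_fun :: "surf \<Rightarrow> real \<times> real \<Rightarrow> real" where "F_fun x p = pu x p \<bullet> pv x p"
definition G_fun :: "surf \<Rightarrow> real \<times> real \<Rightarrow> real" where "G_fun x p = pv x p \<bullet> pv x p"

definition normal :: "surf \<Rightarrow> real \<times> real \<Rightarrow> real^3" where
  "normal x p = (1 / norm (cross3 (pu x p) (pv x p))) *\<^sub>R cross3 (pu x p) (pv x p)"

definition L_fun :: "surf \<Rightarrow> real \<times> real \<Rightarrow> real" where "L_fun x p = pu (pu x) p \<bullet> normal x p"
definition M_fun :: "surf \<Rightarrow> real \<times> real \<Rightarrow> real" where "M_fun x p = pv (pu x) p \<bullet> normal x p"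
definition N_fun :: "surf \<Rightarrow> real \<times> real \<Rightarrow> real" where "N_fun x p = pv (pv x) p \<bullet> normal x p"

definition nu1_of :: "surf \<Rightarrow> real \<times> real \<Rightarrow> real" where "nu1_of x p = L_fun x p / E_fun x p"
definition nu2_of :: "surf \<Rightarrow> real \<times> real \<Rightarrow> real" where "nu2_of x p = N_fun x p / G_fun x p"
definition gamma1_of :: "surf \<Rightarrow> real \<times> real \<Rightarrow> real" where
  "gamma1_of x p = - pv (E_fun x) p / (2 * E_fun x p * sqrt (G_fun x p))"
definition gamma2_of :: "surf \<Rightarrow> real \<times> real \<Rightarrow> real" where
  "gamma2_of x p = pu (G_fun x) p / (2 * G_fun x p * sqrt (E_fun x p))"

definition principal_surface_with_invariants ::
  "(real \<times> real) set \<Rightarrow> surf \<Rightarrow> (real \<times> real \<Rightarrow> real) \<Rightarrow> (real \<times> real \<Rightarrow> real)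
     \<Rightarrow> (real \<times> real \<Rightarrow> real) \<Rightarrow> (real \<times> real \<Rightarrow> real) \<Rightarrow> bool" where
  "principal_surface_with_invariants D0 x n1 n2 g1 g2 \<longleftrightarrow>
     smooth_on D0 x \<and>
     (\<forall>p\<in>D0.
        cross3 (pu x p) (pv x p) \<noteq> 0 \<and>
        F_fun x p = 0 \<and> M_fun x p = 0 \<and>
        (nu1_of x p - nu2_of x p) * gamma1_of x p * gamma2_of x p \<noteq> 0 \<and>
        nu1_of x p - nu2_of x p > 0 \<and>
        nu1_of x p = n1 p \<and> nu2_of x p = n2 p \<and>
        gamma1_of x p = g1 p \<and> gamma2_of x p = g2 p)"

end

theory Submission
  imports Defs
begin

text \<open>
  The Codazzi equations force e = sqrt E = (nu2)_u / (gamma2 (nu1 - nu2)) and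
  g = sqrt G = (nu1)_v / (gamma1 (nu1 - nu2)). Conditions 2.1 then say e_v = - gamma1 e g and
  g_u = gamma2 e g, and 2.2 is the Gauss equation, so that the linear system for the frame (X, Y, l) and the
  position x,
    X_u = e (gamma1 Y + nu1 l), Y_u = - e gamma1 X, l_u = - e nu1 X, x_u = e X,
    X_v = g gamma2 Y, Y_v = g (nu2 l - gamma2 X), l_v = - g nu2 Y, x_v = g Y,
  is compatible and has a local solution. Skew-symmetry keeps the frame orthonormal, so x has the prescribed
  invariants. Two surfaces with the same invariants have frames obeying the same skew-symmetric system; hence the
  rotation taking one frame to the other is constant, and integration gives the translation.
\<close>

section \<open>Partial derivatives and smooth functions of two variables\<close>

text \<open>The metric is not free data: where (n1 - n2) g1 g2 does not vanish, the Codazzi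
  equations are linear equations for sqrt E and sqrt G with nonzero coefficients, so the invariants
  alone fix every coefficient of the frame system. The sign conditions make both roots positive and
  keep the arguments of the logarithms in 2.1 positive. The obstacle is analytic. The frame system
  prescribes both partial derivatives of each unknown, while a fixed point of an integral equation
  is a priori only continuous, with no derivative across the direction of integration. Hence the
  integrability theorem works on a closed rectangle with one-sided derivatives, the initial value
  sits at the lower left corner so that every integral runs forward, and smoothness is regained
  afterwards in the interior from the equations themselves. Starting at the corner instead of at
  (u0, v0) costs nothing, because another initial frame only moves the surface. The neighbourhood is
  an open rectangle because convexity turns vanishing partial derivatives into constancy.\<close>

lemma slice_u_has_derivative:
  assumes "(f has_derivative f') (at p)"
  shows "((\<lambda>t. f (t, snd p)) has_vector_derivative f' (1, 0)) (at (fst p))"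
proof -
  have "((\<lambda>t. (t, snd p)) has_derivative (\<lambda>h. (h, 0))) (at (fst p))"
    by (auto intro!: derivative_eq_intros)
  from diff_chain_at[OF this, of f f'] assms
  have "((\<lambda>t. f (t, snd p)) has_derivative (\<lambda>h. f' (h, 0))) (at (fst p))"
    by (simp add: o_def)
  moreover have "(\<lambda>h. f' (h, 0)) = (\<lambda>h. h *\<^sub>R f' (1, 0))"
  proof
    fix h show "f' (h, 0) = h *\<^sub>R f' (1, 0)"
      using linear_scale[OF has_derivative_linear[OF assms], of h "(1,0)"] by simp
  qed
  ultimately show ?thesis by (simp only: has_vector_derivative_def)
qed

lemma slice_v_has_derivative:
  assumes "(f has_derivative f') (at p)"
  shows "((\<lambda>t. f (fst p, t)) has_vector_derivative f' (0, 1)) (at (snd p))"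
proof -
  have "((\<lambda>t. (fst p, t)) has_derivative (\<lambda>h. (0, h))) (at (snd p))"
    by (auto intro!: derivative_eq_intros)
  from diff_chain_at[OF this, of f f'] assms
  have "((\<lambda>t. f (fst p, t)) has_derivative (\<lambda>h. f' (0, h))) (at (snd p))"
    by (simp add: o_def)
  moreover have "(\<lambda>h. f' (0, h)) = (\<lambda>h. h *\<^sub>R f' (0, 1))"
  proof
    fix h show "f' (0, h) = h *\<^sub>R f' (0, 1)"
      using linear_scale[OF has_derivative_linear[OF assms], of h "(0,1)"] by simp
  qed
  ultimately show ?thesis by (simp only: has_vector_derivative_def)
qed

lemma has_derivative_pu_eq: "(f has_derivative f') (at p) \<Longrightarrow> pu f p = f' (1, 0)"
  and has_derivative_pv_eq: "(f has_derivative f') (at p) \<Longrightarrow> pv f p = f' (0, 1)"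
  unfolding pu_def pv_def
  by (auto intro!: vector_derivative_at slice_u_has_derivative slice_v_has_derivative)

lemma pu_works:
  "f differentiable (at p) \<Longrightarrow> ((\<lambda>t. f (t, snd p)) has_vector_derivative pu f p) (at (fst p))"
  unfolding differentiable_def by (metis has_derivative_pu_eq slice_u_has_derivative)

lemma pv_works:
  "f differentiable (at p) \<Longrightarrow> ((\<lambda>t. f (fst p, t)) has_vector_derivative pv f p) (at (snd p))"
  unfolding differentiable_def by (metis has_derivative_pv_eq slice_v_has_derivative)

lemma differentiable_cong_open:
  assumes "open D" "p \<in> D" "\<And>q. q \<in> D \<Longrightarrow> f q = g q" "f differentiable (at p)"
  shows "g differentiable (at p)"
  using assms has_derivative_transform_within_open unfolding differentiable_def by metis

text \<open>Partial derivatives see only the germ at \<open>p\<close>. This permits differentiating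
  identities that hold only on an open \<open>D\<close>, although \<open>pu\<close> and
  \<open>pv\<close> act on functions defined on the whole plane.\<close>

lemma partials_cong:
  assumes "open D" "p \<in> D" "\<And>q. q \<in> D \<Longrightarrow> f q = g q"
  shows "pu f p = pu g p" "pv f p = pv g p"
proof -
  have "\<forall>\<^sub>F q in nhds p. f q = g q"
    using assms eventually_nhds by blast
  then have *: "\<forall>\<^sub>F q in nhds (fst p, snd p). f q = g q" by simp
  have "\<forall>\<^sub>F t in nhds (fst p). f (t, snd p) = g (t, snd p)"
  proof -
    have "filterlim (\<lambda>t. (t, snd p)) (nhds (fst p, snd p)) (nhds (fst p))"
      by (intro tendsto_intros filterlim_ident)
    from filterlim_iff[THEN iffD1, OF this, rule_format, OF *] show ?thesis by simp
  qed
  then show "pu f p = pu g p" unfolding pu_def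
    by (intro vector_derivative_cong_eq) (auto simp: eventually_nhds_x_imp_x)
  have "\<forall>\<^sub>F t in nhds (snd p). f (fst p, t) = g (fst p, t)"
  proof -
    have "filterlim (\<lambda>t. (fst p, t)) (nhds (fst p, snd p)) (nhds (snd p))"
      by (intro tendsto_intros filterlim_ident)
    from filterlim_iff[THEN iffD1, OF this, rule_format, OF *] show ?thesis by simp
  qed
  then show "pv f p = pv g p" unfolding pv_def
    by (intro vector_derivative_cong_eq) (auto simp: eventually_nhds_x_imp_x)
qed

text \<open>Stated for an arbitrary bounded bilinear product so that one rule covers real, scalar,
  inner and cross products, products of coordinates, and the action of coefficients on the unknown
  of a linear system.\<close>

lemma partials_bilinear:
  assumes "bounded_bilinear mul" "f differentiable (at p)" "g differentiable (at p)"
  shows "pu (\<lambda>q. mul (f q) (g q)) p = mul (f p) (pu g p) + mul (pu f p) (g p)"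
    and "pv (\<lambda>q. mul (f q) (g q)) p = mul (f p) (pv g p) + mul (pv f p) (g p)"
    and "(\<lambda>q. mul (f q) (g q)) differentiable (at p)"
proof -
  obtain f' g' where D: "(f has_derivative f') (at p)" "(g has_derivative g') (at p)"
    using assms(2,3) by (auto simp: differentiable_def)
  note * = bounded_bilinear.FDERIV[OF assms(1) D]
  show "pu (\<lambda>q. mul (f q) (g q)) p = mul (f p) (pu g p) + mul (pu f p) (g p)"
    and "pv (\<lambda>q. mul (f q) (g q)) p = mul (f p) (pv g p) + mul (pv f p) (g p)"
    and "(\<lambda>q. mul (f q) (g q)) differentiable (at p)"
    using * by (auto simp: has_derivative_pu_eq[OF *] has_derivative_pv_eq[OF *]
        has_derivative_pu_eq[OF D(1)] has_derivative_pv_eq[OF D(1)]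
        has_derivative_pu_eq[OF D(2)] has_derivative_pv_eq[OF D(2)] differentiable_def)
qed

lemma partials_linear:
  assumes "bounded_linear h" "f differentiable (at p)"
  shows "pu (\<lambda>q. h (f q)) p = h (pu f p)"
    and "pv (\<lambda>q. h (f q)) p = h (pv f p)"
    and "(\<lambda>q. h (f q)) differentiable (at p)"
proof -
  obtain f' where D: "(f has_derivative f') (at p)"
    using assms(2) by (auto simp: differentiable_def)
  note * = bounded_linear.has_derivative[OF assms(1) D]
  show "pu (\<lambda>q. h (f q)) p = h (pu f p)" "pv (\<lambda>q. h (f q)) p = h (pv f p)"
    "(\<lambda>q. h (f q)) differentiable (at p)"
    using * by (auto simp: has_derivative_pu_eq[OF *] has_derivative_pv_eq[OF *]
        has_derivative_pu_eq[OF D(1)] has_derivative_pv_eq[OF D(1)] differentiable_def)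
qed

lemma partials_add:
  assumes "f differentiable (at p)" "g differentiable (at p)"
  shows "pu (\<lambda>q. f q + g q) p = pu f p + pu g p"
    and "pv (\<lambda>q. f q + g q) p = pv f p + pv g p"
proof -
  obtain f' g' where D: "(f has_derivative f') (at p)" "(g has_derivative g') (at p)"
    using assms by (auto simp: differentiable_def)
  note * = has_derivative_add[OF D]
  show "pu (\<lambda>q. f q + g q) p = pu f p + pu g p" "pv (\<lambda>q. f q + g q) p = pv f p + pv g p"
    by (auto simp: has_derivative_pu_eq[OF *] has_derivative_pv_eq[OF *]
        has_derivative_pu_eq[OF D(1)] has_derivative_pv_eq[OF D(1)]
        has_derivative_pu_eq[OF D(2)] has_derivative_pv_eq[OF D(2)])
qed

lemma partials_chain:
  fixes f :: "real \<times> real \<Rightarrow> real"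
  assumes "(h has_real_derivative h') (at (f p))" "f differentiable (at p)"
  shows "pu (\<lambda>q. h (f q)) p = h' * pu f p"
    and "pv (\<lambda>q. h (f q)) p = h' * pv f p"
    and "(\<lambda>q. h (f q)) differentiable (at p)"
proof -
  obtain f' where D: "(f has_derivative f') (at p)"
    using assms(2) by (auto simp: differentiable_def)
  note * = diff_chain_at[OF D assms(1)[unfolded has_field_derivative_def], unfolded o_def]
  show "pu (\<lambda>q. h (f q)) p = h' * pu f p" "pv (\<lambda>q. h (f q)) p = h' * pv f p"
    "(\<lambda>q. h (f q)) differentiable (at p)"
    using * by (auto simp: has_derivative_pu_eq[OF *] has_derivative_pv_eq[OF *]
        has_derivative_pu_eq[OF D(1)] has_derivative_pv_eq[OF D(1)] differentiable_def)
qed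

lemma partials_const: "pu (\<lambda>q. c) p = 0" "pv (\<lambda>q. c) p = 0"
  by (auto simp: pu_def pv_def)

text \<open>Finite-order form of \<open>smooth_on\<close>: all iterated partials of length at most n
  are Frechet differentiable. The product rule involves lower-order derivatives of both factors, so
  closure properties need an induction on the order, with the derivative that acts first peeled
  off.\<close>

primrec times_differentiable :: "nat \<Rightarrow> (real \<times> real) set \<Rightarrow> (real \<times> real \<Rightarrow> 'b::real_normed_vector) \<Rightarrow> bool" where
  "times_differentiable 0 D f \<longleftrightarrow> (\<forall>p\<in>D. f differentiable (at p))"
| "times_differentiable (Suc n) D f \<longleftrightarrow> (\<forall>p\<in>D. f differentiable (at p)) \<and>
     times_differentiable n D (pu f) \<and> times_differentiable n D (pv f)"

lemma times_differentiable_pred: "times_differentiable (Suc n) D f \<Longrightarrow> times_differentiable n D f"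
proof (induction n arbitrary: f)
  case (Suc n)
  then show ?case by (metis times_differentiable.simps(2))
qed simp

text \<open>The head of the list is the outermost derivative, so the last element acts on
  \<open>f\<close> itself. This matches the recursion of
  \<open>times_differentiable\<close>.\<close>

lemma iter_partial_snoc: "iter_partial (bs @ [b]) f = iter_partial bs ((if b then pu else pv) f)"
  by (induction bs) auto

lemma smooth_on_differentiable: "smooth_on D f \<Longrightarrow> p \<in> D \<Longrightarrow> f differentiable (at p)"
  unfolding smooth_on_def by (metis iter_partial.simps(1))

lemma smooth_on_pu:
  assumes "smooth_on D f" shows "smooth_on D (pu f)"
proof -
  have "iter_partial ds (pu f) = iter_partial (ds @ [True]) f" for ds
    by (simp add: iter_partial_snoc)
  then show ?thesis using assms unfolding smooth_on_def by simp
qed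

lemma smooth_on_pv:
  assumes "smooth_on D f" shows "smooth_on D (pv f)"
proof -
  have "iter_partial ds (pv f) = iter_partial (ds @ [False]) f" for ds
    by (simp add: iter_partial_snoc)
  then show ?thesis using assms unfolding smooth_on_def by simp
qed

lemma smooth_on_iff: "smooth_on D f \<longleftrightarrow> (\<forall>n. times_differentiable n D f)"
proof
  have "smooth_on D f \<Longrightarrow> times_differentiable n D f" for n
    by (induction n arbitrary: f) (auto intro: smooth_on_differentiable smooth_on_pu smooth_on_pv)
  then show "smooth_on D f \<Longrightarrow> \<forall>n. times_differentiable n D f" by blast
next
  have "times_differentiable (length ds) D f \<Longrightarrow> p \<in> D \<Longrightarrow> iter_partial ds f differentiable (at p)" for ds p
    by (induction ds arbitrary: f rule: rev_induct) (auto simp: iter_partial_snoc)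
  then show "\<forall>n. times_differentiable n D f \<Longrightarrow> smooth_on D f" unfolding smooth_on_def by blast
qed

lemma times_differentiable_cong:
  assumes "open D" "\<And>q. q \<in> D \<Longrightarrow> f q = g q" "times_differentiable n D f"
  shows "times_differentiable n D g"
  using assms(2,3)
proof (induction n arbitrary: f g)
  case 0
  then show ?case using differentiable_cong_open[OF assms(1)] by (metis times_differentiable.simps(1))
next
  case (Suc n)
  have "times_differentiable n D (pu g)" "times_differentiable n D (pv g)"
    using Suc.IH[of "pu f" "pu g"] Suc.IH[of "pv f" "pv g"] partials_cong[OF assms(1), of _ f g] Suc.prems
    by auto
  moreover have "\<forall>p\<in>D. g differentiable (at p)"
    using Suc.prems differentiable_cong_open[OF assms(1), of _ f g] by auto
  ultimately show ?case by simp
qed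

lemma times_differentiable_const: "times_differentiable n D (\<lambda>q. c)"
proof (induction n arbitrary: c)
  case (Suc n)
  have "pu (\<lambda>q. c) = (\<lambda>q. 0)" "pv (\<lambda>q. c) = (\<lambda>q. 0)" using partials_const by blast+
  with Suc[of 0] show ?case by simp
qed auto

lemma times_differentiable_add:
  assumes "open D" "times_differentiable n D f" "times_differentiable n D g"
  shows "times_differentiable n D (\<lambda>q. f q + g q)"
  using assms(2,3)
proof (induction n arbitrary: f g)
  case (Suc n)
  have "times_differentiable n D (\<lambda>q. pu f q + pu g q)" "times_differentiable n D (\<lambda>q. pv f q + pv g q)"
    using Suc by auto
  note d = this
  have "times_differentiable n D (pu (\<lambda>q. f q + g q))"
    by (rule times_differentiable_cong[OF assms(1) _ d(1)]) (use Suc.prems in \<open>auto simp: partials_add\<close>)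
  moreover have "times_differentiable n D (pv (\<lambda>q. f q + g q))"
    by (rule times_differentiable_cong[OF assms(1) _ d(2)]) (use Suc.prems in \<open>auto simp: partials_add\<close>)
  ultimately show ?case using Suc.prems by auto
qed auto

lemma times_differentiable_linear:
  assumes "open D" "bounded_linear h" "times_differentiable n D f"
  shows "times_differentiable n D (\<lambda>q. h (f q))"
  using assms(3)
proof (induction n arbitrary: f)
  case (Suc n)
  have "times_differentiable n D (\<lambda>q. h (pu f q))" "times_differentiable n D (\<lambda>q. h (pv f q))"
    using Suc by auto
  note d = this
  have "times_differentiable n D (pu (\<lambda>q. h (f q)))"
    by (rule times_differentiable_cong[OF assms(1) _ d(1)]) (use Suc.prems in \<open>auto simp: partials_linear[OF assms(2)]\<close>)
  moreover have "times_differentiable n D (pv (\<lambda>q. h (f q)))"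
    by (rule times_differentiable_cong[OF assms(1) _ d(2)]) (use Suc.prems in \<open>auto simp: partials_linear[OF assms(2)]\<close>)
  ultimately show ?case using Suc.prems by (auto simp: partials_linear[OF assms(2)])
qed (auto simp: partials_linear[OF assms(2)])

lemma times_differentiable_bilinear:
  assumes "open D" "bounded_bilinear mul" "times_differentiable n D f" "times_differentiable n D g"
  shows "times_differentiable n D (\<lambda>q. mul (f q) (g q))"
  using assms(3,4)
proof (induction n arbitrary: f g)
  case (Suc n)
  note pr = Suc.prems[THEN times_differentiable_pred]
  have "times_differentiable n D (\<lambda>q. mul (f q) (pu g q) + mul (pu f q) (g q))"
    "times_differentiable n D (\<lambda>q. mul (f q) (pv g q) + mul (pv f q) (g q))"
    using Suc pr by (auto intro!: times_differentiable_add[OF assms(1)])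
  note d = this
  have "times_differentiable n D (pu (\<lambda>q. mul (f q) (g q)))"
    by (rule times_differentiable_cong[OF assms(1) _ d(1)]) (use Suc.prems in \<open>auto simp: partials_bilinear[OF assms(2)]\<close>)
  moreover have "times_differentiable n D (pv (\<lambda>q. mul (f q) (g q)))"
    by (rule times_differentiable_cong[OF assms(1) _ d(2)]) (use Suc.prems in \<open>auto simp: partials_bilinear[OF assms(2)]\<close>)
  ultimately show ?case using Suc.prems by (auto simp: partials_bilinear[OF assms(2)])
qed (auto simp: partials_bilinear[OF assms(2)])

text \<open>The induction feeds itself: the partials of \<open>inverse f\<close> are products of
  \<open>inverse f\<close>, of order n by induction, with a partial of \<open>f\<close>, of order n
  by hypothesis.\<close>

lemma times_differentiable_inverse:
  fixes f :: "real \<times> real \<Rightarrow> real"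
  assumes "open D" "\<And>q. q \<in> D \<Longrightarrow> f q \<noteq> 0" "times_differentiable n D f"
  shows "times_differentiable n D (\<lambda>q. inverse (f q))"
  using assms(3)
proof (induction n)
  case 0
  then show ?case using assms(2) by (auto intro!: partials_chain(3) DERIV_inverse)
next
  case (Suc n)
  have *: "times_differentiable n D (\<lambda>q. inverse (f q))" using Suc by (blast dest: times_differentiable_pred)
  have **: "times_differentiable n D (\<lambda>q. - (inverse (f q) * inverse (f q)) * pu f q)"
    "times_differentiable n D (\<lambda>q. - (inverse (f q) * inverse (f q)) * pv f q)"
    using Suc.prems *
    by (auto intro!: times_differentiable_bilinear[OF assms(1) bounded_bilinear_mult]
        times_differentiable_linear[OF assms(1) bounded_linear_minus[OF bounded_linear_ident]]
        simp del: mult_minus_left)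
  have d: "q \<in> D \<Longrightarrow> (inverse has_real_derivative - (inverse (f q) * inverse (f q))) (at (f q))" for q
    using DERIV_inverse[of "f q" UNIV] assms(2)[of q] by (simp add: power2_eq_square)
  have "times_differentiable n D (pu (\<lambda>q. inverse (f q)))"
    by (rule times_differentiable_cong[OF assms(1) _ **(1)]) (use Suc.prems in \<open>auto simp: partials_chain[OF d]\<close>)
  moreover have "times_differentiable n D (pv (\<lambda>q. inverse (f q)))"
    by (rule times_differentiable_cong[OF assms(1) _ **(2)]) (use Suc.prems in \<open>auto simp: partials_chain[OF d]\<close>)
  ultimately show ?case using Suc.prems by (auto intro!: partials_chain(3)[OF d])
qed

text \<open>Same scheme as for the inverse: a partial of \<open>sqrt f\<close> is half a partial of
  \<open>f\<close> times the inverse of \<open>sqrt f\<close>, and that inverse has order n by the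
  induction hypothesis.\<close>

lemma times_differentiable_sqrt:
  fixes f :: "real \<times> real \<Rightarrow> real"
  assumes "open D" "\<And>q. q \<in> D \<Longrightarrow> f q > 0" "times_differentiable n D f"
  shows "times_differentiable n D (\<lambda>q. sqrt (f q))"
  using assms(3)
proof (induction n)
  case 0
  then show ?case using assms(2) by (auto intro!: partials_chain(3)[OF DERIV_real_sqrt])
next
  case (Suc n)
  have *: "times_differentiable n D (\<lambda>q. inverse (sqrt (f q)))"
  proof (rule times_differentiable_inverse[OF assms(1)])
    show "sqrt (f q) \<noteq> 0" if "q \<in> D" for q using assms(2)[OF that] by simp
    show "times_differentiable n D (\<lambda>q. sqrt (f q))"
      using Suc.IH times_differentiable_pred[OF Suc.prems] by blast
  qed
  have **: "times_differentiable n D (\<lambda>q. (inverse (sqrt (f q)) * (1/2)) * pu f q)"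
    "times_differentiable n D (\<lambda>q. (inverse (sqrt (f q)) * (1/2)) * pv f q)"
    by (intro times_differentiable_bilinear[OF assms(1) bounded_bilinear_mult] times_differentiable_const *;
        use Suc.prems in simp)+
  have d: "q \<in> D \<Longrightarrow> (sqrt has_real_derivative inverse (sqrt (f q)) * (1/2)) (at (f q))" for q
    using DERIV_real_sqrt[of "f q"] assms(2)[of q] by (simp add: field_simps)
  have "times_differentiable n D (pu (\<lambda>q. sqrt (f q)))"
    by (rule times_differentiable_cong[OF assms(1) _ **(1)]) (use Suc.prems in \<open>auto simp: partials_chain[OF d]\<close>)
  moreover have "times_differentiable n D (pv (\<lambda>q. sqrt (f q)))"
    by (rule times_differentiable_cong[OF assms(1) _ **(2)]) (use Suc.prems in \<open>auto simp: partials_chain[OF d]\<close>)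
  ultimately show ?case using Suc.prems by (auto intro!: partials_chain(3)[OF d])
qed

section \<open>Closure properties of smooth functions\<close>

lemma smooth_on_subset: "smooth_on D f \<Longrightarrow> D' \<subseteq> D \<Longrightarrow> smooth_on D' f"
  unfolding smooth_on_def by blast

lemma smooth_on_const: "smooth_on D (\<lambda>q. c)"
  unfolding smooth_on_iff using times_differentiable_const by blast

lemma smooth_on_add:
  "open D \<Longrightarrow> smooth_on D f \<Longrightarrow> smooth_on D g \<Longrightarrow> smooth_on D (\<lambda>q. f q + g q)"
  unfolding smooth_on_iff using times_differentiable_add by blast

lemma smooth_on_linear:
  "bounded_linear h \<Longrightarrow> open D \<Longrightarrow> smooth_on D f \<Longrightarrow> smooth_on D (\<lambda>q. h (f q))"
  unfolding smooth_on_iff using times_differentiable_linear by blast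

lemma smooth_on_bilinear:
  "bounded_bilinear mul \<Longrightarrow> open D \<Longrightarrow> smooth_on D f \<Longrightarrow> smooth_on D g \<Longrightarrow> smooth_on D (\<lambda>q. mul (f q) (g q))"
  unfolding smooth_on_iff using times_differentiable_bilinear by blast

lemma smooth_on_inverse:
  fixes f :: "real \<times> real \<Rightarrow> real"
  shows "open D \<Longrightarrow> (\<And>q. q \<in> D \<Longrightarrow> f q \<noteq> 0) \<Longrightarrow> smooth_on D f \<Longrightarrow> smooth_on D (\<lambda>q. inverse (f q))"
  unfolding smooth_on_iff using times_differentiable_inverse by blast

lemma smooth_on_sqrt:
  fixes f :: "real \<times> real \<Rightarrow> real"
  shows "open D \<Longrightarrow> (\<And>q. q \<in> D \<Longrightarrow> f q > 0) \<Longrightarrow> smooth_on D f \<Longrightarrow> smooth_on D (\<lambda>q. sqrt (f q))"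
  unfolding smooth_on_iff using times_differentiable_sqrt by blast

lemmas smooth_on_mult = smooth_on_bilinear[OF bounded_bilinear_mult]
lemmas smooth_on_scaleR = smooth_on_bilinear[OF bounded_bilinear_scaleR]
lemmas smooth_on_inner = smooth_on_bilinear[OF bounded_bilinear_inner]
lemmas smooth_on_minus = smooth_on_linear[OF bounded_linear_minus[OF bounded_linear_ident]]

lemma smooth_on_diff:
  "open D \<Longrightarrow> smooth_on D f \<Longrightarrow> smooth_on D g \<Longrightarrow> smooth_on D (\<lambda>q. f q - g q)"
  using smooth_on_add[OF _ _ smooth_on_minus, of D f g] by simp

lemma smooth_on_divide:
  fixes f g :: "real \<times> real \<Rightarrow> real"
  shows "open D \<Longrightarrow> (\<And>q. q \<in> D \<Longrightarrow> g q \<noteq> 0) \<Longrightarrow> smooth_on D f \<Longrightarrow> smooth_on D g \<Longrightarrow> smooth_on D (\<lambda>q. f q / g q)"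
  unfolding divide_inverse by (intro smooth_on_mult smooth_on_inverse)

lemma smooth_on_Pair:
  assumes "open D" "smooth_on D f" "smooth_on D g"
  shows "smooth_on D (\<lambda>q. (f q, g q))"
proof -
  have "bounded_linear (\<lambda>x. (x, 0))" "bounded_linear (\<lambda>y. (0, y))"
    by (auto intro: bounded_linear_Pair bounded_linear_ident bounded_linear_zero)
  from smooth_on_add[OF assms(1) smooth_on_linear[OF this(1) assms(1,2)] smooth_on_linear[OF this(2) assms(1,3)]]
  show ?thesis by simp
qed

lemma smooth_on_continuous_on: "smooth_on D f \<Longrightarrow> continuous_on D f"
  by (meson continuous_at_imp_continuous_on differentiable_imp_continuous_within smooth_on_differentiable)

lemma partials_Pair:
  assumes "f differentiable (at p)" "g differentiable (at p)"
  shows "pu (\<lambda>q. (f q, g q)) p = (pu f p, pu g p)" "pv (\<lambda>q. (f q, g q)) p = (pv f p, pv g p)"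
proof -
  obtain f' g' where D: "(f has_derivative f') (at p)" "(g has_derivative g') (at p)"
    using assms by (auto simp: differentiable_def)
  note * = has_derivative_Pair[OF D]
  show "pu (\<lambda>q. (f q, g q)) p = (pu f p, pu g p)" "pv (\<lambda>q. (f q, g q)) p = (pv f p, pv g p)"
    by (auto simp: has_derivative_pu_eq[OF *] has_derivative_pv_eq[OF *]
        has_derivative_pu_eq[OF D(1)] has_derivative_pv_eq[OF D(1)]
        has_derivative_pu_eq[OF D(2)] has_derivative_pv_eq[OF D(2)])
qed

section \<open>Equality of mixed partials, and functions with vanishing partials\<close>

lemma square_in_open:
  fixes u0 v0 :: real
  assumes "open D" "(u0, v0) \<in> D"
  obtains r where "r > 0" "{u0 - r..u0 + r} \<times> {v0 - r..v0 + r} \<subseteq> D"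
proof -
  obtain U V where UV: "open U" "open V" "(u0, v0) \<in> U \<times> V" "U \<times> V \<subseteq> D"
    using open_prod_elim[OF assms] by blast
  obtain r1 r2 where r: "r1 > 0" "cball u0 r1 \<subseteq> U" "r2 > 0" "cball v0 r2 \<subseteq> V"
    using UV open_contains_cball by (metis mem_Sigma_iff)
  show ?thesis
  proof (rule that[of "min r1 r2"])
    show "0 < min r1 r2" using r by simp
    have "{u0 - min r1 r2..u0 + min r1 r2} \<subseteq> U" "{v0 - min r1 r2..v0 + min r1 r2} \<subseteq> V"
      using r by (auto simp: cball_eq_atLeastAtMost intro!: subsetD[of "{u0 - r1..u0 + r1}" U]
          subsetD[of "{v0 - r2..v0 + r2}" V])
    then show "{u0 - min r1 r2..u0 + min r1 r2} \<times> {v0 - min r1 r2..v0 + min r1 r2} \<subseteq> D"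
      using UV by blast
  qed
qed

lemma continuous_on_slice:
  assumes "continuous_on (S \<times> T) f"
  shows "v \<in> T \<Longrightarrow> continuous_on S (\<lambda>s. f (s, v))" "u \<in> S \<Longrightarrow> continuous_on T (\<lambda>t. f (u, t))"
  by (auto intro!: continuous_on_compose2[OF assms] continuous_intros)

text \<open>Write f(u, v) as f(a, v) plus the integral of \<open>pu f\<close> from a to u.
  Differentiating under the integral sign in v exhibits \<open>pv f\<close> along the line v = v0 as
  a constant plus the integral of \<open>pv (pu f)\<close>, and the fundamental theorem then
  differentiates in u. A closed square inside \<open>D\<close> supplies the base line u = a and the
  paths of integration.\<close>

lemma mixed_partials_commute:
  fixes f :: "real \<times> real \<Rightarrow> 'b::banach"
  assumes D: "open D" and f: "smooth_on D f" and "p \<in> D"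
  shows "pv (pu f) p = pu (pv f) p"
proof -
  obtain u0 v0 where p: "p = (u0, v0)" by fastforce
  obtain r where r: "r > 0" "{u0 - r..u0 + r} \<times> {v0 - r..v0 + r} \<subseteq> D"
    using square_in_open[OF D] assms(3) p by blast
  let ?U = "{u0 - r..u0 + r}" and ?V = "{v0 - r..v0 + r}"
  let ?a = "u0 - r"
  have dif: "f differentiable (at q)" "pu f differentiable (at q)" "pv f differentiable (at q)"
    if "q \<in> ?U \<times> ?V" for q
    using that r(2) f smooth_on_differentiable smooth_on_pu smooth_on_pv by blast+
  have c: "continuous_on (?U \<times> ?V) (pu f)" "continuous_on (?U \<times> ?V) (pv (pu f))"
    using f r(2) smooth_on_continuous_on smooth_on_pu smooth_on_pv continuous_on_subset by metis+
  have ftc: "((\<lambda>s. pu f (s, v)) has_integral (f (u, v) - f (?a, v))) {?a..u}"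
    if "u \<in> ?U" "v \<in> ?V" for u v
    using that pu_works[OF dif(1)]
    by (intro fundamental_theorem_of_calculus) (auto intro: has_vector_derivative_at_within)
  have pv_eq: "pv f (u, v0) = pv f (?a, v0) + integral {?a..u} (\<lambda>s. pv (pu f) (s, v0))"
    if u: "u \<in> {?a..u0 + r}" for u
  proof -
    have "((\<lambda>v. integral (cbox ?a u) (\<lambda>s. pu f (s, v))) has_vector_derivative
        integral (cbox ?a u) (\<lambda>s. pv (pu f) (s, v0))) (at v0 within ?V)"
    proof (rule leibniz_rule_vector_derivative)
      show "((\<lambda>x. pu f (t, x)) has_vector_derivative pv (pu f) (t, x)) (at x within ?V)"
        if "x \<in> ?V" "t \<in> cbox ?a u" for x t
        using pv_works[OF dif(2), of "(t, x)"] that u by (auto intro: has_vector_derivative_at_within)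
      show "(\<lambda>s. pu f (s, x)) integrable_on cbox ?a u" if "x \<in> ?V" for x
        using ftc[OF u that] by auto
      show "continuous_on (?V \<times> cbox ?a u) (\<lambda>(x, t). pv (pu f) (t, x))"
        using u unfolding case_prod_beta
        by (auto intro!: continuous_on_compose2[OF c(2)] continuous_intros)
    qed (use r in auto)
    then have "((\<lambda>v. integral {?a..u} (\<lambda>s. pu f (s, v))) has_vector_derivative
        integral {?a..u} (\<lambda>s. pv (pu f) (s, v0))) (at v0)"
      using r by (auto simp: at_within_Icc_at)
    moreover have "((\<lambda>v. f (?a, v)) has_vector_derivative pv f (?a, v0)) (at v0)"
      using pv_works[OF dif(1), of "(?a, v0)"] r by auto
    ultimately have deriv: "((\<lambda>v. f (?a, v) + integral {?a..u} (\<lambda>s. pu f (s, v))) has_vector_derivative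
        pv f (?a, v0) + integral {?a..u} (\<lambda>s. pv (pu f) (s, v0))) (at v0)"
      by (intro has_vector_derivative_add)
    have eq: "f (?a, v) + integral {?a..u} (\<lambda>s. pu f (s, v)) = f (u, v)"
      if "v \<in> {v0 - r<..<v0 + r}" for v
      using integral_unique[OF ftc[OF u, of v]] that by simp
    have "((\<lambda>v. f (u, v)) has_vector_derivative
        pv f (?a, v0) + integral {?a..u} (\<lambda>s. pv (pu f) (s, v0))) (at v0)"
      by (rule has_vector_derivative_transform_within_open[OF deriv, of "{v0 - r<..<v0 + r}"])
         (use r eq in auto)
    then show ?thesis by (simp add: pv_def vector_derivative_at)
  qed
  have "((\<lambda>u. integral {?a..u} (\<lambda>s. pv (pu f) (s, v0))) has_vector_derivative pv (pu f) (u0, v0)) (at u0 within ?U)"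
    using continuous_on_slice(1)[OF c(2), of v0] r by (intro integral_has_vector_derivative) auto
  then have "((\<lambda>u. pv f (?a, v0) + integral {?a..u} (\<lambda>s. pv (pu f) (s, v0))) has_vector_derivative pv (pu f) (u0, v0)) (at u0)"
    using r by (auto simp: at_within_Icc_at intro!: derivative_eq_intros)
  then have "((\<lambda>u. pv f (u, v0)) has_vector_derivative pv (pu f) (u0, v0)) (at u0)"
    by (rule has_vector_derivative_transform_within_open[of _ _ _ "{u0 - r<..<u0 + r}"])
       (use r in auto, rule pv_eq[symmetric], auto)
  then show ?thesis unfolding p pu_def[of "pv f"] by (simp add: vector_derivative_at)
qed

lemma constant_of_zero_partials:
  fixes f :: "real \<times> real \<Rightarrow> 'b::real_normed_vector"
  assumes "convex D" "\<And>p. p \<in> D \<Longrightarrow> f differentiable (at p)" "\<And>p. p \<in> D \<Longrightarrow> pu f p = 0"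
    "\<And>p. p \<in> D \<Longrightarrow> pv f p = 0" "p \<in> D" "q \<in> D"
  shows "f p = f q"
proof -
  have "(f has_derivative (\<lambda>h. 0)) (at x within D)" if x: "x \<in> D" for x
  proof -
    obtain f' where f': "(f has_derivative f') (at x)"
      using assms(2)[OF x] by (auto simp: differentiable_def)
    have "f' h = 0" for h
    proof -
      interpret f': linear f' by (rule has_derivative_linear[OF f'])
      have "h = fst h *\<^sub>R (1, 0) + snd h *\<^sub>R (0, 1)" by (cases h) simp
      then have "f' h = fst h *\<^sub>R f' (1, 0) + snd h *\<^sub>R f' (0, 1)"
        by (metis f'.add f'.scale)
      then show ?thesis
        using assms(3,4)[OF x] has_derivative_pu_eq[OF f'] has_derivative_pv_eq[OF f'] by simp
    qed
    then have "f' = (\<lambda>h. 0)" by auto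
    with f' show ?thesis using has_derivative_at_withinI by blast
  qed
  then obtain c where "\<And>x. x \<in> D \<Longrightarrow> f x = c"
    using has_derivative_zero_constant[OF assms(1), of f] by blast
  then show ?thesis using assms by metis
qed

section \<open>Integrability of linear systems\<close>

text \<open>The moving upper limit is traded for a fixed one: freezing the integrand at its value at
  v for t beyond v gives an integral over the whole interval, which is continuous in the parameters,
  and the excess \<open>(d - v) *\<^sub>R f (u, v)\<close> is subtracted.\<close>

lemma continuous_on_integral_upper_limit:
  fixes f :: "real \<times> real \<Rightarrow> 'b::banach"
  assumes f: "continuous_on (S \<times> {c..d}) f"
  shows "continuous_on (S \<times> {c..d}) (\<lambda>p. integral {c..snd p} (\<lambda>t. f (fst p, t)))"
proof -
  have eq: "integral (cbox c d) (\<lambda>t. f (u, min t v)) - (d - v) *\<^sub>R f (u, v) = integral {c..v} (\<lambda>t. f (u, t))"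
    if uv: "u \<in> S" "v \<in> {c..d}" for u v
  proof -
    have "continuous_on {c..d} (\<lambda>t. f (u, min t v))"
      using uv by (auto intro!: continuous_on_compose2[OF f] continuous_intros)
    then have "integral {c..v} (\<lambda>t. f (u, min t v)) + integral {v..d} (\<lambda>t. f (u, min t v))
      = integral {c..d} (\<lambda>t. f (u, min t v))"
      using uv by (intro Henstock_Kurzweil_Integration.integral_combine integrable_continuous_real) auto
    moreover have "integral {c..v} (\<lambda>t. f (u, min t v)) = integral {c..v} (\<lambda>t. f (u, t))"
      by (intro Henstock_Kurzweil_Integration.integral_cong) (auto simp: min_def)
    moreover have "integral {v..d} (\<lambda>t. f (u, min t v)) = integral {v..d} (\<lambda>t. f (u, v))"
      by (intro Henstock_Kurzweil_Integration.integral_cong) (auto simp: min_def)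
    ultimately show ?thesis using uv by (simp add: algebra_simps)
  qed
  have "continuous_on (S \<times> {c..d})
      (\<lambda>p. integral (cbox c d) (\<lambda>t. f (fst p, min t (snd p))) - (d - snd p) *\<^sub>R f p)"
    by (intro continuous_intros integral_continuous_on_param f)
       (auto simp: case_prod_beta intro!: continuous_on_compose2[OF f] continuous_intros)
  then show ?thesis
    by (rule continuous_on_eq) (use eq in \<open>auto simp: mem_Times_iff\<close>)
qed

lemma continuous_on_integral_upper_limit':
  fixes f :: "real \<times> real \<Rightarrow> 'b::banach"
  assumes f: "continuous_on ({a..b} \<times> T) f"
  shows "continuous_on ({a..b} \<times> T) (\<lambda>p. integral {a..fst p} (\<lambda>s. f (s, snd p)))"
proof -
  have "continuous_on (T \<times> {a..b}) (\<lambda>q. f (snd q, fst q))"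
    by (auto intro!: continuous_on_compose2[OF f] continuous_intros)
  then have "continuous_on ({a..b} \<times> T)
      (\<lambda>p. integral {a..snd (snd p, fst p)} (\<lambda>t. f (snd (fst (snd p, fst p), t), fst (fst (snd p, fst p), t))))"
    by (rule continuous_on_compose2[OF continuous_on_integral_upper_limit]) (auto intro!: continuous_intros)
  then show ?thesis by simp
qed

text \<open>Banach's fixed point theorem for the operator that integrates the u-equation along the
  lower edge v = c and then the v-equation upwards. By the smallness hypotheses each of the two
  integrals contributes a factor 1/4 in the supremum norm, together a contraction by 1/2.\<close>

lemma picard_rectangle:
  fixes act :: "'m::real_normed_vector \<Rightarrow> 'a::banach \<Rightarrow> 'a" and s0 :: 'a
  assumes act: "bounded_bilinear act" and le: "a \<le> b" "c \<le> d"
    and A: "continuous_on ({a..b} \<times> {c..d}) A" and B: "continuous_on ({a..b} \<times> {c..d}) B"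
    and C: "\<And>p s. p \<in> {a..b} \<times> {c..d} \<Longrightarrow> norm (act (A p) s) \<le> C * norm s"
      "\<And>p s. p \<in> {a..b} \<times> {c..d} \<Longrightarrow> norm (act (B p) s) \<le> C * norm s"
    and C0: "0 \<le> C" and small: "C * (b - a) \<le> 1/4" "C * (d - c) \<le> 1/4"
  shows "\<exists>\<Phi>. continuous_on ({a..b} \<times> {c..d}) \<Phi> \<and>
    (\<forall>p \<in> {a..b} \<times> {c..d}. \<Phi> p = s0 + integral {a..fst p} (\<lambda>s. act (A (s, c)) (\<Phi> (s, c)))
        + integral {c..snd p} (\<lambda>t. act (B (fst p, t)) (\<Phi> (fst p, t))))"
proof -
  let ?R = "{a..b} \<times> {c..d}"
  interpret act: bounded_bilinear act by fact
  have box: "cbox (a, c) (b, d) = ?R" by (auto simp: cbox_Pair_eq)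
  define F where "F \<phi> p = s0 + integral {a..fst p} (\<lambda>s. act (A (s, c)) (\<phi> (s, c)))
        + integral {c..snd p} (\<lambda>t. act (B (fst p, t)) (\<phi> (fst p, t)))" for \<phi> and p :: "real \<times> real"
  have contA: "continuous_on ?R (\<lambda>q. act (A q) (\<phi> q))" and contB: "continuous_on ?R (\<lambda>q. act (B q) (\<phi> q))"
    if "continuous_on ?R \<phi>" for \<phi>
    using that A B by (auto intro!: act.continuous_on)
  have contF: "continuous_on ?R (F \<phi>)" if \<phi>: "continuous_on ?R \<phi>" for \<phi>
  proof -
    have "continuous_on {a..b} (\<lambda>u. integral {a..u} (\<lambda>s. act (A (s, c)) (\<phi> (s, c))))"
      by (intro indefinite_integral_continuous_1 integrable_continuous_real
          continuous_on_slice(1)[OF contA[OF \<phi>]]) (use le in auto)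
    then have "continuous_on ?R (\<lambda>p. integral {a..fst p} (\<lambda>s. act (A (s, c)) (\<phi> (s, c))))"
      by (rule continuous_on_compose2) (auto intro!: continuous_intros)
    then show ?thesis unfolding F_def
      by (intro continuous_intros continuous_on_integral_upper_limit[OF contB[OF \<phi>]])
  qed
  \<comment> \<open>The bounded continuous functions on the whole plane form a complete type.
    Clamping the argument to the rectangle extends \<open>F \<phi>\<close> to the plane and makes
    the operator a self-map of that type.\<close>
  have "\<exists>g::(real \<times> real) \<Rightarrow>\<^sub>C 'a. \<forall>x. g x = F \<phi> (clamp (a, c) (b, d) x)"
    for \<phi> :: "(real \<times> real) \<Rightarrow>\<^sub>C 'a"
    using continuous_on_cbox_bcontfunE[of "(a, c)" "(b, d)" "F \<phi>"] contF[of \<phi>]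
    unfolding box by (metis continuous_on_apply_bcontfun)
  then obtain T :: "((real \<times> real) \<Rightarrow>\<^sub>C 'a) \<Rightarrow> ((real \<times> real) \<Rightarrow>\<^sub>C 'a)"
    where T: "\<And>\<phi> x. T \<phi> x = F \<phi> (clamp (a, c) (b, d) x)"
    by metis
  have contr: "dist (T \<phi>) (T \<psi>) \<le> 1/2 * dist \<phi> \<psi>" for \<phi> \<psi>
  proof (rule dist_bound)
    fix x
    obtain u v where uv: "clamp (a, c) (b, d) x = (u, v)" by fastforce
    have "clamp (a, c) (b, d) x \<in> ?R"
      unfolding box[symmetric] using le by (intro clamp_in_interval) (auto simp: Basis_prod_def)
    then have in_R: "u \<in> {a..b}" "v \<in> {c..d}" by (simp_all add: uv)
    let ?\<delta> = "\<lambda>q. \<phi> q - \<psi> q"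
    have ci: "continuous_on {a..u} (\<lambda>s. act (A (s, c)) (\<xi> (s, c)))"
      "continuous_on {c..v} (\<lambda>t. act (B (u, t)) (\<xi> (u, t)))" if "continuous_on ?R \<xi>" for \<xi>
      using continuous_on_slice(1)[OF contA[OF that], of c]
        continuous_on_slice(2)[OF contB[OF that], of u] in_R le
      by (auto intro: continuous_on_subset)
    have cd: "continuous_on ?R \<phi>" "continuous_on ?R \<psi>" "continuous_on ?R ?\<delta>"
      by (auto intro!: continuous_intros)
    have eq: "F \<phi> (u, v) - F \<psi> (u, v) = integral {a..u} (\<lambda>s. act (A (s, c)) (?\<delta> (s, c)))
        + integral {c..v} (\<lambda>t. act (B (u, t)) (?\<delta> (u, t)))"
      using ci cd
      by (simp add: F_def act.diff_right Henstock_Kurzweil_Integration.integral_diff integrable_continuous_real)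
    have "norm (integral {a..u} (\<lambda>s. act (A (s, c)) (?\<delta> (s, c)))) \<le> (C * dist \<phi> \<psi>) * (u - a)"
    proof (intro integral_bound ci cd ballI)
      fix s assume "s \<in> {a..u}"
      then show "norm (act (A (s, c)) (?\<delta> (s, c))) \<le> C * dist \<phi> \<psi>"
        using in_R le C(1)[of "(s, c)" "?\<delta> (s, c)"] dist_bounded[of \<phi> "(s, c)" \<psi>] C0
        by (auto simp: dist_norm intro: order_trans mult_left_mono)
    qed (use in_R in auto)
    moreover have "norm (integral {c..v} (\<lambda>t. act (B (u, t)) (?\<delta> (u, t)))) \<le> (C * dist \<phi> \<psi>) * (v - c)"
    proof (intro integral_bound ci cd ballI)
      fix t assume "t \<in> {c..v}"
      then show "norm (act (B (u, t)) (?\<delta> (u, t))) \<le> C * dist \<phi> \<psi>"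
        using in_R le C(2)[of "(u, t)" "?\<delta> (u, t)"] dist_bounded[of \<phi> "(u, t)" \<psi>] C0
        by (auto simp: dist_norm intro: order_trans mult_left_mono)
    qed (use in_R in auto)
    moreover have "(C * dist \<phi> \<psi>) * (u - a) \<le> 1/4 * dist \<phi> \<psi>"
    proof -
      have "C * (u - a) \<le> C * (b - a)" using in_R C0 by (intro mult_left_mono) auto
      with small(1) have "(C * (u - a)) * dist \<phi> \<psi> \<le> 1/4 * dist \<phi> \<psi>" by (intro mult_right_mono) auto
      then show ?thesis by (simp add: ac_simps)
    qed
    moreover have "(C * dist \<phi> \<psi>) * (v - c) \<le> 1/4 * dist \<phi> \<psi>"
    proof -
      have "C * (v - c) \<le> C * (d - c)" using in_R C0 by (intro mult_left_mono) auto
      with small(2) have "(C * (v - c)) * dist \<phi> \<psi> \<le> 1/4 * dist \<phi> \<psi>" by (intro mult_right_mono) auto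
      then show ?thesis by (simp add: ac_simps)
    qed
    ultimately have "norm (F \<phi> (u, v) - F \<psi> (u, v)) \<le> 1/2 * dist \<phi> \<psi>"
      unfolding eq
      using norm_triangle_ineq[of "integral {a..u} (\<lambda>s. act (A (s, c)) (?\<delta> (s, c)))"
          "integral {c..v} (\<lambda>t. act (B (u, t)) (?\<delta> (u, t)))"] by linarith
    then show "dist (T \<phi> x) (T \<psi> x) \<le> 1/2 * dist \<phi> \<psi>"
      by (simp add: T uv dist_norm)
  qed
  obtain \<phi> where \<phi>: "T \<phi> = \<phi>"
    using banach_fix_type[of "1/2" T] contr by auto
  show ?thesis
  proof (intro exI[of _ "apply_bcontfun \<phi>"] conjI ballI)
    fix p assume p: "p \<in> ?R"
    then have "clamp (a, c) (b, d) p = p" by (simp add: box)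
    then show "\<phi> p = s0 + integral {a..fst p} (\<lambda>s. act (A (s, c)) (\<phi> (s, c)))
        + integral {c..snd p} (\<lambda>t. act (B (fst p, t)) (\<phi> (fst p, t)))"
      using T[of \<phi> p] unfolding \<phi> F_def by simp
  qed simp
qed

text \<open>The Picard solution solves the v-equation everywhere and the u-equation on the edge v = c. Its defect
  \<rho> in the u-equation satisfies \<rho>_v = B \<rho> - integral of B_u \<rho> by the compatibility condition, and vanishes for
  v = c; on a small rectangle this forces \<rho> = 0, without any differentiability in the parameter u.\<close>

lemma frobenius_rectangle:
  fixes act :: "'m::real_normed_vector \<Rightarrow> 'a::banach \<Rightarrow> 'a" and s0 :: 'a
  assumes act: "bounded_bilinear act" and le: "a < b" "c < d"
    and R: "{a..b} \<times> {c..d} \<subseteq> D" and smooth: "smooth_on D A" "smooth_on D B"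
    and C: "\<And>p s. p \<in> {a..b} \<times> {c..d} \<Longrightarrow> norm (act (A p) s) \<le> C * norm s"
      "\<And>p s. p \<in> {a..b} \<times> {c..d} \<Longrightarrow> norm (act (B p) s) \<le> C * norm s"
      "\<And>p s. p \<in> {a..b} \<times> {c..d} \<Longrightarrow> norm (act (pu B p) s) \<le> C * norm s"
    and C0: "0 \<le> C" and small: "C * (b - a) \<le> 1/4" "C * (d - c) \<le> 1/4" "b - a \<le> 1"
    and compat: "\<And>p s. p \<in> {a..b} \<times> {c..d} \<Longrightarrow>
      act (pv A p) s + act (A p) (act (B p) s) = act (pu B p) s + act (B p) (act (A p) s)"
  obtains \<Phi> where "continuous_on ({a..b} \<times> {c..d}) \<Phi>" "\<Phi> (a, c) = s0"
    "\<And>u v. u \<in> {a..b} \<Longrightarrow> v \<in> {c..d} \<Longrightarrow>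
        ((\<lambda>s. \<Phi> (s, v)) has_vector_derivative act (A (u, v)) (\<Phi> (u, v))) (at u within {a..b})"
    "\<And>u v. u \<in> {a..b} \<Longrightarrow> v \<in> {c..d} \<Longrightarrow>
        ((\<lambda>t. \<Phi> (u, t)) has_vector_derivative act (B (u, v)) (\<Phi> (u, v))) (at v within {c..d})"
proof -
  let ?R = "{a..b} \<times> {c..d}"
  interpret act: bounded_bilinear act by fact
  have contR: "continuous_on ?R A" "continuous_on ?R B" "continuous_on ?R (pu B)" "continuous_on ?R (pv A)"
    using smooth smooth_on_pu smooth_on_pv smooth_on_continuous_on R continuous_on_subset by metis+
  have dif: "p \<in> ?R \<Longrightarrow> A differentiable (at p)" "p \<in> ?R \<Longrightarrow> B differentiable (at p)" for p
    using smooth R smooth_on_differentiable by blast+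
  have ex: "\<exists>\<Phi>. continuous_on ?R \<Phi> \<and>
    (\<forall>p \<in> ?R. \<Phi> p = s0 + integral {a..fst p} (\<lambda>s. act (A (s, c)) (\<Phi> (s, c)))
        + integral {c..snd p} (\<lambda>t. act (B (fst p, t)) (\<Phi> (fst p, t))))"
    by (rule picard_rectangle[OF act]) (use le contR C C0 small in auto)
  obtain \<Phi> where \<Phi>: "continuous_on ?R \<Phi>"
    "\<And>p. p \<in> ?R \<Longrightarrow> \<Phi> p = s0 + integral {a..fst p} (\<lambda>s. act (A (s, c)) (\<Phi> (s, c)))
        + integral {c..snd p} (\<lambda>t. act (B (fst p, t)) (\<Phi> (fst p, t)))"
    using ex by blast
  have cA: "continuous_on ?R (\<lambda>q. act (A q) (\<phi> q))" and cB: "continuous_on ?R (\<lambda>q. act (B q) (\<phi> q))"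
    and cBu: "continuous_on ?R (\<lambda>q. act (pu B q) (\<phi> q))" and cAv: "continuous_on ?R (\<lambda>q. act (pv A q) (\<phi> q))"
    if "continuous_on ?R \<phi>" for \<phi>
    using that contR by (auto intro!: act.continuous_on)
  have dv: "((\<lambda>t. \<Phi> (u, t)) has_vector_derivative act (B (u, v)) (\<Phi> (u, v))) (at v within {c..d})"
    if u: "u \<in> {a..b}" and v: "v \<in> {c..d}" for u v
  proof -
    have "((\<lambda>t. integral {c..t} (\<lambda>t. act (B (u, t)) (\<Phi> (u, t)))) has_vector_derivative act (B (u, v)) (\<Phi> (u, v)))
        (at v within {c..d})"
      by (rule integral_has_vector_derivative[OF continuous_on_slice(2)[OF cB[OF \<Phi>(1)] u] v])
    then have "((\<lambda>t. s0 + integral {a..u} (\<lambda>s. act (A (s, c)) (\<Phi> (s, c)))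
        + integral {c..t} (\<lambda>t. act (B (u, t)) (\<Phi> (u, t)))) has_vector_derivative act (B (u, v)) (\<Phi> (u, v)))
        (at v within {c..d})"
      by (auto intro!: derivative_eq_intros)
    then show ?thesis
      by (rule has_vector_derivative_transform[OF v, rotated]) (use \<Phi>(2) u in auto)
  qed
  \<comment> \<open>\<open>P\<close> integrates the u-equation horizontally from the left edge, with
    the values of \<open>\<Phi>\<close> inside the integral. It has a u-derivative by the
    fundamental theorem even while none is known for \<open>\<Phi>\<close>, so the defect can be
    measured as \<open>P - \<Phi>\<close>.\<close>
  define P where "P p = \<Phi> (a, snd p) + integral {a..fst p} (\<lambda>s. act (A (s, snd p)) (\<Phi> (s, snd p)))" for p
  have contP: "continuous_on ?R P"
    unfolding P_def
    by (intro continuous_intros continuous_on_integral_upper_limit'[OF cA[OF \<Phi>(1)]])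
       (auto intro!: continuous_on_compose2[OF \<Phi>(1)] continuous_intros less_imp_le[OF le(1)])
  have Pu: "((\<lambda>s. P (s, v)) has_vector_derivative act (A (u, v)) (\<Phi> (u, v))) (at u within {a..b})"
    if u: "u \<in> {a..b}" and v: "v \<in> {c..d}" for u v
    using integral_has_vector_derivative[OF continuous_on_slice(1)[OF cA[OF \<Phi>(1)] v] u]
    unfolding P_def by (auto intro!: derivative_eq_intros)
  let ?\<rho> = "\<lambda>p. P p - \<Phi> p"
  have cont\<rho>: "continuous_on ?R ?\<rho>" by (intro continuous_intros contP \<Phi>(1))
  have \<rho>v: "((\<lambda>t. ?\<rho> (u, t)) has_vector_derivative
      act (B (u, v)) (?\<rho> (u, v)) - integral {a..u} (\<lambda>s. act (pu B (s, v)) (?\<rho> (s, v)))) (at v within {c..d})"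
    if u: "u \<in> {a..b}" and v: "v \<in> {c..d}" for u v
  proof -
    \<comment> \<open>The v-derivative of \<open>act (A q) (\<Phi> q)\<close>, with the v-derivative
      of \<open>\<Phi>\<close> already replaced through the v-equation.\<close>
    let ?g = "\<lambda>q. act (A q) (act (B q) (\<Phi> q)) + act (pv A q) (\<Phi> q)"
    have contg: "continuous_on ?R ?g"
      by (intro continuous_intros cA cB cAv \<Phi>(1))
    have "((\<lambda>t. integral (cbox a u) (\<lambda>s. act (A (s, t)) (\<Phi> (s, t)))) has_vector_derivative
        integral (cbox a u) (\<lambda>s. ?g (s, v))) (at v within {c..d})"
    proof (rule leibniz_rule_vector_derivative)
      fix t s assume ts: "t \<in> {c..d}" "s \<in> cbox a u"
      then have s: "s \<in> {a..b}" using u by auto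
      have "((\<lambda>t. A (s, t)) has_vector_derivative pv A (s, t)) (at t within {c..d})"
        using pv_works[OF dif(1), of "(s, t)"] ts s by (auto intro: has_vector_derivative_at_within)
      from act.has_vector_derivative[OF this dv[OF s ts(1)]]
      show "((\<lambda>t. act (A (s, t)) (\<Phi> (s, t))) has_vector_derivative ?g (s, t)) (at t within {c..d})" .
    next
      fix t assume t: "t \<in> {c..d}"
      show "(\<lambda>s. act (A (s, t)) (\<Phi> (s, t))) integrable_on cbox a u"
        unfolding cbox_interval using u
        by (intro integrable_continuous_real continuous_on_subset[OF continuous_on_slice(1)[OF cA[OF \<Phi>(1)] t]]) auto
    next
      show "continuous_on ({c..d} \<times> cbox a u) (\<lambda>(t, s). ?g (s, t))"
        using u unfolding case_prod_beta
        by (intro continuous_on_compose2[OF contg]) (auto intro!: continuous_intros)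
    qed (use v in auto)
    then have D1: "((\<lambda>t. P (u, t)) has_vector_derivative
        act (B (a, v)) (\<Phi> (a, v)) + integral {a..u} (\<lambda>s. ?g (s, v))) (at v within {c..d})"
      unfolding P_def cbox_interval fst_conv snd_conv
      by (intro has_vector_derivative_add dv) (use le v in auto)
    \<comment> \<open>The u-derivative of \<open>act (B q) (P q)\<close>, because the u-derivative
      of \<open>P\<close> is A applied to \<Phi>. Its integral collapses to boundary terms, and
      \<open>compat\<close> rewrites \<open>?g\<close> as \<open>?h\<close> minus B_u applied to the
      defect.\<close>
    let ?h = "\<lambda>q. act (B q) (act (A q) (\<Phi> q)) + act (pu B q) (P q)"
    have conth: "continuous_on ?R ?h"
      by (intro continuous_intros cA cB cBu \<Phi>(1) contP)
    have "((\<lambda>s. ?h (s, v)) has_integral act (B (u, v)) (P (u, v)) - act (B (a, v)) (P (a, v))) {a..u}"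
    proof (rule fundamental_theorem_of_calculus)
      fix s assume "s \<in> {a..u}"
      then have s: "s \<in> {a..b}" using u by auto
      have "((\<lambda>s. B (s, v)) has_vector_derivative pu B (s, v)) (at s within {a..b})"
        using pu_works[OF dif(2), of "(s, v)"] v s by (auto intro: has_vector_derivative_at_within)
      from act.has_vector_derivative[OF this Pu[OF s v]]
      show "((\<lambda>s. act (B (s, v)) (P (s, v))) has_vector_derivative ?h (s, v)) (at s within {a..u})"
        using u by (auto intro: has_vector_derivative_within_subset)
    qed (use u in auto)
    then have I1: "integral {a..u} (\<lambda>s. ?h (s, v)) = act (B (u, v)) (P (u, v)) - act (B (a, v)) (\<Phi> (a, v))"
      by (simp add: integral_unique P_def)
    have sub: "continuous_on {a..u} (\<lambda>s. k (s, v))" if "continuous_on ?R k" for k :: "real \<times> real \<Rightarrow> 'a"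
      using u by (intro continuous_on_subset[OF continuous_on_slice(1)[OF that v]]) auto
    have "integral {a..u} (\<lambda>s. ?g (s, v)) = integral {a..u} (\<lambda>s. ?h (s, v) - act (pu B (s, v)) (?\<rho> (s, v)))"
    proof (rule Henstock_Kurzweil_Integration.integral_cong)
      fix s assume "s \<in> {a..u}"
      then have "(s, v) \<in> ?R" using u v by auto
      from compat[OF this, of "\<Phi> (s, v)"]
      show "?g (s, v) = ?h (s, v) - act (pu B (s, v)) (?\<rho> (s, v))"
        by (simp add: act.diff_right algebra_simps)
    qed
    also have "\<dots> = integral {a..u} (\<lambda>s. ?h (s, v)) - integral {a..u} (\<lambda>s. act (pu B (s, v)) (?\<rho> (s, v)))"
      by (intro Henstock_Kurzweil_Integration.integral_diff integrable_continuous_real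
          sub[OF conth] sub[OF cBu[OF cont\<rho>]])
    finally have eq: "act (B (a, v)) (\<Phi> (a, v)) + integral {a..u} (\<lambda>s. ?g (s, v)) - act (B (u, v)) (\<Phi> (u, v))
        = act (B (u, v)) (?\<rho> (u, v)) - integral {a..u} (\<lambda>s. act (pu B (s, v)) (?\<rho> (s, v)))"
      unfolding I1 by (simp add: act.diff_right algebra_simps)
    show ?thesis using has_vector_derivative_diff[OF D1 dv[OF u v]] unfolding eq .
  qed
  obtain q where q: "q \<in> ?R" "\<And>p. p \<in> ?R \<Longrightarrow> norm (?\<rho> p) \<le> norm (?\<rho> q)"
  proof -
    have "compact ?R" "?R \<noteq> {}" "continuous_on ?R (\<lambda>p. norm (?\<rho> p))"
      using le by (auto intro!: compact_Times continuous_on_norm cont\<rho>)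
    from continuous_attains_sup[OF this] show ?thesis using that by blast
  qed
  define M where "M = norm (?\<rho> q)"
  have M0: "M \<ge> 0" by (simp add: M_def)
  obtain u v where uv: "q = (u, v)" "u \<in> {a..b}" "v \<in> {c..d}" using q(1) by (cases q) auto
  \<comment> \<open>The constant 2 C M adds C M for the B term to at most C M for the integral,
    whose interval has length at most 1. Since C (d - c) is at most 1/4, the maximum M of the norm
    of the defect is at most M / 2.\<close>
  have "norm (?\<rho> (u, v) - ?\<rho> (u, c)) \<le> 2 * C * M * norm (v - c)"
  proof (rule differentiable_bound)
    fix t assume t: "t \<in> {c..d}"
    show "((\<lambda>t. ?\<rho> (u, t)) has_derivative (\<lambda>h. h *\<^sub>R (act (B (u, t)) (?\<rho> (u, t)) - integral {a..u} (\<lambda>s. act (pu B (s, t)) (?\<rho> (s, t))))))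
        (at t within {c..d})"
      using \<rho>v[OF uv(2) t] unfolding has_vector_derivative_def .
    have n1: "norm (act (B (u, t)) (?\<rho> (u, t))) \<le> C * M"
      using C(2)[of "(u, t)" "?\<rho> (u, t)"] q(2)[of "(u, t)"] uv t C0
      unfolding M_def by (auto intro: order_trans mult_left_mono)
    have n2: "norm (integral {a..u} (\<lambda>s. act (pu B (s, t)) (?\<rho> (s, t)))) \<le> C * M * (u - a)"
    proof (rule integral_bound)
      show "continuous_on {a..u} (\<lambda>s. act (pu B (s, t)) (?\<rho> (s, t)))"
        using uv by (intro continuous_on_subset[OF continuous_on_slice(1)[OF cBu[OF cont\<rho>] t]]) auto
      fix s assume "s \<in> {a..u}"
      then show "norm (act (pu B (s, t)) (?\<rho> (s, t))) \<le> C * M"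
        using C(3)[of "(s, t)" "?\<rho> (s, t)"] q(2)[of "(s, t)"] uv t C0
        unfolding M_def by (auto intro: order_trans mult_left_mono)
    qed (use uv in auto)
    have "C * M * (u - a) \<le> C * M * 1"
      using uv small(3) C0 M0 by (intro mult_left_mono) auto
    with n1 n2 have "norm (act (B (u, t)) (?\<rho> (u, t)) - integral {a..u} (\<lambda>s. act (pu B (s, t)) (?\<rho> (s, t)))) \<le> 2 * C * M"
      using norm_triangle_ineq4[of "act (B (u, t)) (?\<rho> (u, t))" "integral {a..u} (\<lambda>s. act (pu B (s, t)) (?\<rho> (s, t)))"]
      by linarith
    then show "onorm (\<lambda>h. h *\<^sub>R (act (B (u, t)) (?\<rho> (u, t)) - integral {a..u} (\<lambda>s. act (pu B (s, t)) (?\<rho> (s, t))))) \<le> 2 * C * M"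
      by (simp add: onorm_scaleR_left onorm_id)
  qed (use uv le in auto)
  moreover have "?\<rho> (u, c) = 0"
    using \<Phi>(2)[of "(u, c)"] \<Phi>(2)[of "(a, c)"] uv le by (simp add: P_def)
  moreover have "2 * C * M * norm (v - c) \<le> M / 2"
  proof -
    have "C * (v - c) \<le> C * (d - c)" using uv C0 by (intro mult_left_mono) auto
    with small(2) have "2 * M * (C * (v - c)) \<le> 2 * M * (1/4)" using M0 by (intro mult_left_mono) auto
    then show ?thesis using uv by (simp add: ac_simps)
  qed
  moreover have "M = norm (?\<rho> (u, v))" by (simp add: M_def uv)
  ultimately have "M \<le> M / 2" by (metis diff_zero order_trans)
  then have "M = 0" using M0 by simp
  then have eq: "P p = \<Phi> p" if "p \<in> ?R" for p
    using q(2)[OF that] by (simp add: M_def)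
  show ?thesis
  proof (rule that[OF \<Phi>(1) _ _ dv])
    show "\<Phi> (a, c) = s0" using \<Phi>(2)[of "(a, c)"] le by simp
    show "((\<lambda>s. \<Phi> (s, v)) has_vector_derivative act (A (u, v)) (\<Phi> (u, v))) (at u within {a..b})"
      if "u \<in> {a..b}" "v \<in> {c..d}" for u v
      by (rule has_vector_derivative_transform[OF that(1) _ Pu[OF that]]) (use eq that in auto)
  qed
qed

text \<open>The increment splits into a u-step on the line through the point, governed by the single
  derivative \<open>fu\<close>, and a v-step governed by the mean value inequality and the
  continuity of \<open>fv\<close>. Hence the asymmetric treatment of the two partials.\<close>

lemma differentiable_of_continuous_partials:
  fixes f :: "real \<times> real \<Rightarrow> 'b::real_normed_vector"
  assumes "open S" "open T" "convex T" "(u, v) \<in> S \<times> T"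
    and fu: "((\<lambda>s. f (s, v)) has_vector_derivative fu) (at u)"
    and fv: "\<And>u v. u \<in> S \<Longrightarrow> v \<in> T \<Longrightarrow> ((\<lambda>t. f (u, t)) has_vector_derivative fv (u, v)) (at v)"
    and cont: "continuous_on (S \<times> T) fv"
  shows "f differentiable (at (u, v))"
proof -
  have "((\<lambda>(x, y). f (x, y)) has_derivative (\<lambda>(tx, ty). tx *\<^sub>R fu + blinfun_scaleR_left (fv (u, v)) ty)) (at (u, v) within S \<times> T)"
  proof (rule has_derivative_partialsI)
    show "((\<lambda>x. f (x, v)) has_derivative (\<lambda>tx. tx *\<^sub>R fu)) (at u within S)"
      using fu unfolding has_vector_derivative_def by (rule has_derivative_at_withinI)
    show "((\<lambda>y. f (x, y)) has_derivative blinfun_apply (blinfun_scaleR_left (fv (x, y)))) (at y within T)"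
      if "x \<in> S" "y \<in> T" for x y
      using fv[OF that] unfolding has_vector_derivative_eq_has_derivative_blinfun
      by (rule has_derivative_at_withinI)
    have "continuous_on (S \<times> T) (\<lambda>q. blinfun_scaleR_left (fv q))"
      by (intro continuous_intros cont)
    then show "continuous (at (u, v) within S \<times> T) (\<lambda>(x, y). blinfun_scaleR_left (fv (x, y)))"
      using assms(4) by (simp add: continuous_on_eq_continuous_within case_prod_unfold)
  qed (use assms in auto)
  then show ?thesis
    using assms at_within_open[of "(u, v)" "S \<times> T"]
    by (auto simp: differentiable_def open_Times)
qed

text \<open>Bootstrapping: order n for the solution gives order n for the right-hand sides, which
  are its partials, and so order n + 1 for the solution.\<close>

lemma smooth_on_linear_system:
  assumes act: "bounded_bilinear act" and D: "open D"
    and AB: "smooth_on D A" "smooth_on D B"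
    and dif: "\<And>p. p \<in> D \<Longrightarrow> \<Phi> differentiable (at p)"
    and eqs: "\<And>p. p \<in> D \<Longrightarrow> pu \<Phi> p = act (A p) (\<Phi> p)" "\<And>p. p \<in> D \<Longrightarrow> pv \<Phi> p = act (B p) (\<Phi> p)"
  shows "smooth_on D \<Phi>"
proof -
  have "times_differentiable n D \<Phi>" for n
  proof (induction n)
    case (Suc n)
    have "times_differentiable n D (\<lambda>p. act (A p) (\<Phi> p))" "times_differentiable n D (\<lambda>p. act (B p) (\<Phi> p))"
      using AB Suc by (auto simp: smooth_on_iff intro!: times_differentiable_bilinear[OF D act])
    note times_differentiable_cong[OF D _ this(1), of "pu \<Phi>"] times_differentiable_cong[OF D _ this(2), of "pv \<Phi>"]
    then have "times_differentiable n D (pu \<Phi>)" "times_differentiable n D (pv \<Phi>)"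
      using eqs by simp_all
    then show ?case using dif by simp
  qed (use dif in simp)
  then show ?thesis by (simp add: smooth_on_iff)
qed

text \<open>Derivatives are available only in the interior, whereas the initial value is prescribed
  at the corner. Continuity up to the closure carries the constant there.\<close>

lemma constant_on_rectangle:
  fixes f :: "real \<times> real \<Rightarrow> 'b::real_normed_vector"
  assumes le: "a < b" "c < d" and cont: "continuous_on ({a..b} \<times> {c..d}) f"
    and f: "\<And>p. p \<in> {a<..<b} \<times> {c<..<d} \<Longrightarrow> f differentiable (at p)"
      "\<And>p. p \<in> {a<..<b} \<times> {c<..<d} \<Longrightarrow> pu f p = 0"
      "\<And>p. p \<in> {a<..<b} \<times> {c<..<d} \<Longrightarrow> pv f p = 0"
    and p: "p \<in> {a<..<b} \<times> {c<..<d}"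
  shows "f p = f (a, c)"
proof -
  let ?Q = "{a<..<b} \<times> {c<..<d}"
  have cl: "closure ?Q = {a..b} \<times> {c..d}" using le by (simp add: closure_Times)
  have "f q = f p" if "q \<in> ?Q" for q
    by (rule constant_of_zero_partials[of ?Q]) (use f p that in \<open>auto intro: convex_Times\<close>)
  then have "f (a, c) = f p"
    using continuous_constant_on_closure[of ?Q f "f p" "(a, c)"] cont cl le by simp
  then show ?thesis by simp
qed

text \<open>Compactness of a closed square around (u0, v0) bounds the coefficients; a smaller
  concentric square then satisfies the smallness conditions of the integrability theorem. The value
  \<open>s0\<close> is taken at its lower left corner, while smoothness and the equations are
  asserted in the interior.\<close>

lemma frobenius_local:
  fixes act :: "'m::real_normed_vector \<Rightarrow> 'a::banach \<Rightarrow> 'a"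
  assumes act: "bounded_bilinear act" and D: "open D" "(u0, v0) \<in> D"
    and smooth: "smooth_on D A" "smooth_on D B"
    and compat: "\<And>p s. p \<in> D \<Longrightarrow>
      act (pv A p) s + act (A p) (act (B p) s) = act (pu B p) s + act (B p) (act (A p) s)"
  obtains a b c d \<Phi> where "a < u0" "u0 < b" "c < v0" "v0 < d" "{a..b} \<times> {c..d} \<subseteq> D"
    "continuous_on ({a..b} \<times> {c..d}) \<Phi>" "\<Phi> (a, c) = s0"
    "smooth_on ({a<..<b} \<times> {c<..<d}) \<Phi>"
    "\<And>p. p \<in> {a<..<b} \<times> {c<..<d} \<Longrightarrow> pu \<Phi> p = act (A p) (\<Phi> p)"
    "\<And>p. p \<in> {a<..<b} \<times> {c<..<d} \<Longrightarrow> pv \<Phi> p = act (B p) (\<Phi> p)"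
proof -
  interpret act: bounded_bilinear act by fact
  obtain r0 where r0: "r0 > 0" "{u0 - r0..u0 + r0} \<times> {v0 - r0..v0 + r0} \<subseteq> D"
    using square_in_open[OF D] by blast
  let ?R0 = "{u0 - r0..u0 + r0} \<times> {v0 - r0..v0 + r0}"
  have bdd: "\<exists>N. \<forall>p\<in>?R0. norm (k p) \<le> N" if "smooth_on D k" for k :: "real \<times> real \<Rightarrow> 'm"
  proof -
    have "compact (k ` ?R0)"
      using smooth_on_continuous_on[OF that] r0(2)
      by (intro compact_continuous_image compact_Times compact_Icc) (auto intro: continuous_on_subset)
    then show ?thesis using compact_imp_bounded bounded_iff by (metis imageI)
  qed
  obtain N1 N2 N3 where N: "\<And>p. p \<in> ?R0 \<Longrightarrow> norm (A p) \<le> N1" "\<And>p. p \<in> ?R0 \<Longrightarrow> norm (B p) \<le> N2"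
    "\<And>p. p \<in> ?R0 \<Longrightarrow> norm (pu B p) \<le> N3"
    using bdd[OF smooth(1)] bdd[OF smooth(2)] bdd[OF smooth_on_pu[OF smooth(2)]] by metis
  obtain K where K: "K \<ge> 0" "\<And>m s. norm (act m s) \<le> norm m * norm s * K"
    using act.nonneg_bounded by blast
  \<comment> \<open>A single operator bound that serves \<open>A\<close>, \<open>B\<close> and
    \<open>pu B\<close> at once.\<close>
  define C where "C = (\<bar>N1\<bar> + \<bar>N2\<bar> + \<bar>N3\<bar>) * K"
  have C0: "C \<ge> 0" using K by (simp add: C_def)
  have C: "norm (act m s) \<le> C * norm s" if "norm m \<le> \<bar>N1\<bar> + \<bar>N2\<bar> + \<bar>N3\<bar>" for m s
  proof -
    have "norm m * norm s * K \<le> (\<bar>N1\<bar> + \<bar>N2\<bar> + \<bar>N3\<bar>) * norm s * K"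
      using that K by (intro mult_right_mono) auto
    with K(2)[of m s] show ?thesis by (simp add: C_def ac_simps)
  qed
  \<comment> \<open>The sides of the rectangle are 2 r: the entry \<open>r0\<close> keeps it inside
    \<open>D\<close>, 1/2 makes its width at most 1, and the last entry makes C times a side at most
    1/4. Adding 1 to \<open>C\<close> keeps the denominator positive when \<open>C\<close> is
    0.\<close>
  define r where "r = min r0 (min (1/2) (1 / (8 * (C + 1))))"
  have r: "r > 0" "r \<le> r0" "r \<le> 1/2" "r \<le> 1 / (8 * (C + 1))"
  proof -
    show "r > 0" using r0 C0 by (simp add: r_def)
  qed (unfold r_def, linarith+)
  have Cr: "C * (2 * r) \<le> 1/4"
  proof -
    have "C * (2 * r) \<le> C * (2 * (1 / (8 * (C + 1))))"
      using r(4) C0 by (intro mult_left_mono) auto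
    also have "\<dots> \<le> 1/4" using C0 by (simp add: field_simps)
    finally show ?thesis .
  qed
  define a b c d where "a = u0 - r" "b = u0 + r" "c = v0 - r" "d = v0 + r"
  note abcd = a_b_c_d_def
  have lt: "a < u0" "u0 < b" "c < v0" "v0 < d" "a < b" "c < d" using r by (auto simp: abcd)
  have R: "{a..b} \<times> {c..d} \<subseteq> ?R0" using r by (auto simp: abcd)
  have bounds: "norm (A p) \<le> \<bar>N1\<bar> + \<bar>N2\<bar> + \<bar>N3\<bar>" "norm (B p) \<le> \<bar>N1\<bar> + \<bar>N2\<bar> + \<bar>N3\<bar>"
     "norm (pu B p) \<le> \<bar>N1\<bar> + \<bar>N2\<bar> + \<bar>N3\<bar>" if "p \<in> {a..b} \<times> {c..d}" for p
    using N[OF subsetD[OF R that]] by linarith+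
  obtain \<Phi> where \<Phi>: "continuous_on ({a..b} \<times> {c..d}) \<Phi>" "\<Phi> (a, c) = s0"
    "\<And>u v. u \<in> {a..b} \<Longrightarrow> v \<in> {c..d} \<Longrightarrow>
        ((\<lambda>s. \<Phi> (s, v)) has_vector_derivative act (A (u, v)) (\<Phi> (u, v))) (at u within {a..b})"
    "\<And>u v. u \<in> {a..b} \<Longrightarrow> v \<in> {c..d} \<Longrightarrow>
        ((\<lambda>t. \<Phi> (u, t)) has_vector_derivative act (B (u, v)) (\<Phi> (u, v))) (at v within {c..d})"
  proof (rule frobenius_rectangle[OF act lt(5,6) subset_trans[OF R r0(2)] smooth, of C])
    show "act (pv A p) s + act (A p) (act (B p) s) = act (pu B p) s + act (B p) (act (A p) s)"
      if "p \<in> {a..b} \<times> {c..d}" for p s using compat that R r0(2) by blast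
    show "C * (b - a) \<le> 1/4" "C * (d - c) \<le> 1/4" "b - a \<le> 1"
      using Cr r by (auto simp: abcd)
  qed (use C bounds C0 in blast)+
  let ?Q = "{a<..<b} \<times> {c<..<d}"
  have du: "((\<lambda>s. \<Phi> (s, v)) has_vector_derivative act (A (u, v)) (\<Phi> (u, v))) (at u)"
    if "u \<in> {a<..<b}" "v \<in> {c<..<d}" for u v
    using \<Phi>(3)[of u v] that by (simp add: at_within_Icc_at)
  have dv: "((\<lambda>s. \<Phi> (u, s)) has_vector_derivative act (B (u, v)) (\<Phi> (u, v))) (at v)"
    if "u \<in> {a<..<b}" "v \<in> {c<..<d}" for u v
    using \<Phi>(4)[of u v] that by (simp add: at_within_Icc_at)
  have pu: "pu \<Phi> p = act (A p) (\<Phi> p)" and pv: "pv \<Phi> p = act (B p) (\<Phi> p)" if "p \<in> ?Q" for p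
    using du[of "fst p" "snd p"] dv[of "fst p" "snd p"] that
    by (auto simp: pu_def pv_def vector_derivative_at)
  have QR: "?Q \<subseteq> {a..b} \<times> {c..d}" by auto
  have Q: "open ?Q" "?Q \<subseteq> D"
    using subset_trans[OF QR subset_trans[OF R r0(2)]] by (auto intro!: open_Times)
  have cont: "continuous_on ?Q (\<lambda>q. act (B q) (\<Phi> q))"
    using smooth_on_continuous_on[OF smooth(2)] Q(2) QR \<Phi>(1)
    by (intro act.continuous_on) (auto intro: continuous_on_subset)
  have dif: "\<Phi> differentiable (at p)" if p: "p \<in> ?Q" for p
    using differentiable_of_continuous_partials[of "{a<..<b}" "{c<..<d}" "fst p" "snd p" \<Phi>, OF _ _ _ _ du dv cont] p
    by auto
  have "smooth_on ?Q \<Phi>"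
    by (rule smooth_on_linear_system[OF act Q(1) smooth_on_subset[OF smooth(1) Q(2)] smooth_on_subset[OF smooth(2) Q(2)]
        dif pu pv])
  then show ?thesis
    using that[OF lt(1-4) subset_trans[OF R r0(2)] \<Phi>(1,2)] pu pv by blast
qed

section \<open>Moving frames and uniqueness\<close>

lemmas bounded_bilinear_cross3 = bilinear_cross[unfolded bilinear_conv_bounded_bilinear]

text \<open>The frame vectors are the rows, so the product is a sum of three outer products. For an
  orthonormal unprimed frame it is the linear map that sends that frame to the primed one.\<close>

lemma transpose_frame_mult_entry:
  fixes X Y l X' Y' l' :: "real^3"
  shows "(transpose (vector [X', Y', l'] :: real^3^3) ** vector [X, Y, l]) $ i $ j
    = X' $ i * X $ j + Y' $ i * Y $ j + l' $ i * l $ j"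
  by (simp add: matrix_matrix_mult_def transpose_def sum_3)

lemma frame_mult_transpose:
  fixes X Y l :: "real^3"
  shows "vector [X, Y, l] ** transpose (vector [X, Y, l] :: real^3^3) = mat 1 \<longleftrightarrow>
    X \<bullet> X = 1 \<and> Y \<bullet> Y = 1 \<and> l \<bullet> l = 1 \<and> X \<bullet> Y = 0 \<and> X \<bullet> l = 0 \<and> Y \<bullet> l = 0"
  by (auto simp: vec_eq_iff matrix_matrix_mult_def transpose_def forall_3 sum_3 mat_def inner_vec_def ac_simps)

lemma rotation_frameI:
  fixes X Y :: "real^3"
  assumes "X \<bullet> X = 1" "Y \<bullet> Y = 1" "X \<bullet> Y = 0"
  shows "rotation_matrix (vector [X, Y, cross3 X Y] :: real^3^3)"
proof -
  have "cross3 X Y \<bullet> cross3 X Y = 1" "X \<bullet> cross3 X Y = 0" "Y \<bullet> cross3 X Y = 0"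
    using assms by (simp_all add: dot_cross dot_cross_self inner_commute)
  then have "vector [X, Y, cross3 X Y] ** transpose (vector [X, Y, cross3 X Y] :: real^3^3) = mat 1"
    using assms by (simp add: frame_mult_transpose)
  moreover have "det (vector [X, Y, cross3 X Y] :: real^3^3) = 1"
    using assms by (simp add: dot_cross_det[symmetric] Lagrange inner_diff_right inner_commute)
  ultimately show ?thesis
    unfolding rotation_matrix_def orthogonal_matrix_def by (metis matrix_left_right_inverse)
qed

lemma rotation_frameD:
  fixes X Y l :: "real^3"
  assumes "rotation_matrix (vector [X, Y, l] :: real^3^3)"
  shows "X \<bullet> X = 1" "Y \<bullet> Y = 1" "X \<bullet> Y = 0" "l = cross3 X Y"
proof -
  have "vector [X, Y, l] ** transpose (vector [X, Y, l] :: real^3^3) = mat 1"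
    and det: "det (vector [X, Y, l] :: real^3^3) = 1"
    using assms by (auto simp: rotation_matrix_def orthogonal_matrix_def)
  then have on: "X \<bullet> X = 1" "Y \<bullet> Y = 1" "X \<bullet> Y = 0" and l: "l \<bullet> l = 1"
    by (auto simp: frame_mult_transpose)
  then show "X \<bullet> X = 1" "Y \<bullet> Y = 1" "X \<bullet> Y = 0" by simp_all
  have "cross3 X Y \<bullet> cross3 X Y = 1" using on by (simp add: dot_cross inner_commute)
  moreover have "l \<bullet> cross3 X Y = 1"
    using det by (simp add: cross3_simps)
  \<comment> \<open>Equality case of Cauchy-Schwarz: two unit vectors with inner product 1 have
    difference of squared length 1 - 2 + 1 = 0.\<close>
  ultimately have "(l - cross3 X Y) \<bullet> (l - cross3 X Y) = 0"
    using l by (simp add: inner_diff_left inner_diff_right inner_commute)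
  then show "l = cross3 X Y" by simp
qed

lemma rotation_frame_expansion:
  fixes X Y w :: "real^3"
  assumes "X \<bullet> X = 1" "Y \<bullet> Y = 1" "X \<bullet> Y = 0"
  shows "w = (w \<bullet> X) *\<^sub>R X + (w \<bullet> Y) *\<^sub>R Y + (w \<bullet> cross3 X Y) *\<^sub>R cross3 X Y"
proof -
  let ?M = "vector [X, Y, cross3 X Y] :: real^3^3"
  have "transpose ?M ** ?M = mat 1"
    using rotation_frameI[OF assms] by (auto simp: rotation_matrix_def orthogonal_matrix_def)
  then have "w = transpose ?M *v (?M *v w)"
    by (simp add: matrix_vector_mul_assoc)
  also have "\<dots> = (w \<bullet> X) *\<^sub>R X + (w \<bullet> Y) *\<^sub>R Y + (w \<bullet> cross3 X Y) *\<^sub>R cross3 X Y"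
    by (simp add: vec_eq_iff matrix_vector_mult_def transpose_def sum_3 inner_vec_def algebra_simps)
  finally show ?thesis .
qed

text \<open>The structure equations of a frame along principal parameters, at one point and with
  skew-symmetric coefficients. That the u-derivative of Y has no l component and the v-derivative of
  X has none either expresses M = 0. Orthonormality is left out, since it has to be deduced from the
  equations in the existence part.\<close>

definition moving_frame_at :: "surf \<Rightarrow> surf \<Rightarrow> surf \<Rightarrow> real \<Rightarrow> real \<Rightarrow> real \<Rightarrow> real \<Rightarrow> real \<times> real \<Rightarrow> bool" where
  "moving_frame_at X Y l a1 b1 a2 d2 p \<longleftrightarrow>
     X differentiable (at p) \<and> Y differentiable (at p) \<and> l differentiable (at p) \<and>
     pu X p = a1 *\<^sub>R Y p + b1 *\<^sub>R l p \<and> pu Y p = - (a1 *\<^sub>R X p) \<and> pu l p = - (b1 *\<^sub>R X p) \<and>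
     pv X p = a2 *\<^sub>R Y p \<and> pv Y p = d2 *\<^sub>R l p - a2 *\<^sub>R X p \<and> pv l p = - (d2 *\<^sub>R Y p)"

lemma bounded_bilinear_entry: "bounded_bilinear (\<lambda>x y::real^3. x $ i * y $ j)"
  unfolding bilinear_conv_bounded_bilinear[symmetric] bilinear_def
  by (auto intro!: linearI simp: algebra_simps)

text \<open>Let the rows of M and M' be the vectors of two frames obeying M_u = S M and M'_u = S M' with the same
  skew-symmetric S. Then the transpose of M' times M has zero derivative; these are its entries.\<close>

lemma moving_frames_product_partials:
  assumes "moving_frame_at X Y l a1 b1 a2 d2 p" "moving_frame_at X' Y' l' a1 b1 a2 d2 p"
  shows "(\<lambda>q. X' q $ i * X q $ j + Y' q $ i * Y q $ j + l' q $ i * l q $ j) differentiable (at p)"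
    "pu (\<lambda>q. X' q $ i * X q $ j + Y' q $ i * Y q $ j + l' q $ i * l q $ j) p = 0"
    "pv (\<lambda>q. X' q $ i * X q $ j + Y' q $ i * Y q $ j + l' q $ i * l q $ j) p = 0"
proof -
  have d: "X differentiable (at p)" "Y differentiable (at p)" "l differentiable (at p)"
    "X' differentiable (at p)" "Y' differentiable (at p)" "l' differentiable (at p)"
    using assms by (simp_all add: moving_frame_at_def)
  show "(\<lambda>q. X' q $ i * X q $ j + Y' q $ i * Y q $ j + l' q $ i * l q $ j) differentiable (at p)"
    using d by (simp add: partials_bilinear[OF bounded_bilinear_entry])
  have u: "pu X p = a1 *\<^sub>R Y p + b1 *\<^sub>R l p" "pu Y p = - (a1 *\<^sub>R X p)" "pu l p = - (b1 *\<^sub>R X p)"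
    "pu X' p = a1 *\<^sub>R Y' p + b1 *\<^sub>R l' p" "pu Y' p = - (a1 *\<^sub>R X' p)" "pu l' p = - (b1 *\<^sub>R X' p)"
    and v: "pv X p = a2 *\<^sub>R Y p" "pv Y p = d2 *\<^sub>R l p - a2 *\<^sub>R X p" "pv l p = - (d2 *\<^sub>R Y p)"
    "pv X' p = a2 *\<^sub>R Y' p" "pv Y' p = d2 *\<^sub>R l' p - a2 *\<^sub>R X' p" "pv l' p = - (d2 *\<^sub>R Y' p)"
    using assms by (simp_all add: moving_frame_at_def)
  show "pu (\<lambda>q. X' q $ i * X q $ j + Y' q $ i * Y q $ j + l' q $ i * l q $ j) p = 0"
    using d by (simp add: partials_add partials_bilinear[OF bounded_bilinear_entry] u algebra_simps)
  show "pv (\<lambda>q. X' q $ i * X q $ j + Y' q $ i * Y q $ j + l' q $ i * l q $ j) p = 0"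
    using d by (simp add: partials_add partials_bilinear[OF bounded_bilinear_entry] v algebra_simps)
qed

text \<open>A skew-symmetric coefficient matrix has trace zero, so the determinant of the frame is
  constant: each term of the derivative repeats a vector or cancels. This settles the orientation,
  which orthogonality alone leaves as a sign.\<close>

lemma moving_frame_triple_product_partials:
  assumes "moving_frame_at X Y l a1 b1 a2 d2 p"
  shows "(\<lambda>q. X q \<bullet> cross3 (Y q) (l q)) differentiable (at p)"
    "pu (\<lambda>q. X q \<bullet> cross3 (Y q) (l q)) p = 0"
    "pv (\<lambda>q. X q \<bullet> cross3 (Y q) (l q)) p = 0"
  using assms unfolding moving_frame_at_def
  by (simp_all add: partials_bilinear[OF bounded_bilinear_inner] partials_bilinear[OF bounded_bilinear_cross3]
      dot_cross_self cross_add_left cross_add_right cross_mult_left cross_mult_right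
      Cross3.left_diff_distrib Cross3.right_diff_distrib inner_add_left inner_add_right inner_diff_right)

text \<open>The last two conclusions are the Codazzi equations, read off from the mixed partials of the normal;
  they determine e and g from the invariants.\<close>

lemma surface_moving_frame:
  assumes D: "open D" and y: "principal_surface_with_invariants D y n1 n2 g1 g2"
    and n: "smooth_on D n1" "smooth_on D n2"
  obtains X Y l e g where
    "\<And>p. p \<in> D \<Longrightarrow> rotation_matrix (vector [X p, Y p, l p] :: real^3^3)"
    "\<And>p. p \<in> D \<Longrightarrow> pu y p = e p *\<^sub>R X p" "\<And>p. p \<in> D \<Longrightarrow> pv y p = g p *\<^sub>R Y p"
    "\<And>p. p \<in> D \<Longrightarrow> moving_frame_at X Y l (e p * g1 p) (e p * n1 p) (g p * g2 p) (g p * n2 p) p"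
    "\<And>p. p \<in> D \<Longrightarrow> pv n1 p = g1 p * g p * (n1 p - n2 p)"
    "\<And>p. p \<in> D \<Longrightarrow> pu n2 p = g2 p * e p * (n1 p - n2 p)"
proof -
  have sm: "smooth_on D y" using y by (simp add: principal_surface_with_invariants_def)
  have nz: "pu y p \<noteq> 0" "pv y p \<noteq> 0" if "p \<in> D" for p
    using y that by (auto simp: principal_surface_with_invariants_def)
  define e where "e p = sqrt (E_fun y p)" for p
  define g where "g p = sqrt (G_fun y p)" for p
  have E: "E_fun y p > 0" "G_fun y p > 0" if "p \<in> D" for p
    using nz[OF that] by (auto simp: E_fun_def G_fun_def)
  have pos: "e p > 0" "g p > 0" "e p \<noteq> 0" "g p \<noteq> 0" and sq: "E_fun y p = e p * e p" "G_fun y p = g p * g p"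
    if "p \<in> D" for p
    using E[OF that] by (auto simp: e_def g_def)
  have "smooth_on D (E_fun y)" "smooth_on D (G_fun y)"
    unfolding E_fun_def[abs_def] G_fun_def[abs_def]
    by (intro smooth_on_inner D smooth_on_pu smooth_on_pv sm)+
  from smooth_on_sqrt[OF D E(1) this(1)] smooth_on_sqrt[OF D E(2) this(2)]
  have se: "smooth_on D e" and sg: "smooth_on D g"
    unfolding e_def[abs_def] g_def[abs_def] by simp_all
  define X where "X p = inverse (e p) *\<^sub>R pu y p" for p
  define Y where "Y p = inverse (g p) *\<^sub>R pv y p" for p
  define l where "l p = cross3 (X p) (Y p)" for p
  have sX: "smooth_on D X" and sY: "smooth_on D Y"
    unfolding X_def[abs_def] Y_def[abs_def]
    by (intro smooth_on_scaleR D smooth_on_inverse se sg smooth_on_pu smooth_on_pv sm pos; assumption)+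
  have sl: "smooth_on D l"
    unfolding l_def[abs_def] by (intro smooth_on_bilinear[OF bounded_bilinear_cross3] D sX sY)
  note smooth = se sg sX sY sl n
  note dif = smooth[THEN smooth_on_differentiable]
  have yu: "pu y p = e p *\<^sub>R X p" and yv: "pv y p = g p *\<^sub>R Y p" if "p \<in> D" for p
    using pos[OF that] by (simp_all add: X_def Y_def)
  have XX: "X p \<bullet> X p = 1" and YY: "Y p \<bullet> Y p = 1" and XY: "X p \<bullet> Y p = 0" if "p \<in> D" for p
  proof -
    have "pu y p \<bullet> pu y p = e p * e p" "pv y p \<bullet> pv y p = g p * g p" "pu y p \<bullet> pv y p = 0"
      using sq[OF that] y that
      by (auto simp: E_fun_def G_fun_def F_fun_def principal_surface_with_invariants_def)
    then show "X p \<bullet> X p = 1" "Y p \<bullet> Y p = 1" "X p \<bullet> Y p = 0"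
      using pos[OF that] by (simp_all add: X_def Y_def field_simps)
  qed
  have ll: "l p \<bullet> l p = 1" and lX: "l p \<bullet> X p = 0" and lY: "l p \<bullet> Y p = 0" if "p \<in> D" for p
    using XX[OF that] YY[OF that] XY[OF that]
    by (simp_all add: l_def dot_cross dot_cross_self inner_commute)
  have nrm: "normal y p = l p" if "p \<in> D" for p
  proof -
    have "cross3 (pu y p) (pv y p) = (e p * g p) *\<^sub>R l p"
      using that by (simp add: yu yv l_def cross_mult_left cross_mult_right)
    moreover have "norm (l p) = 1" using ll[OF that] by (simp add: norm_eq_1)
    ultimately show ?thesis using pos[OF that] by (simp add: normal_def)
  qed
  \<comment> \<open>Differentiating the constant inner products of the frame makes the coefficient
    matrix skew-symmetric, so only three entries per direction have to be computed.\<close>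
  have const_partials: "f p \<bullet> pu h p + pu f p \<bullet> h p = 0" "f p \<bullet> pv h p + pv f p \<bullet> h p = 0"
    if p: "p \<in> D" and fh: "smooth_on D f" "smooth_on D h" and c: "\<And>q. q \<in> D \<Longrightarrow> f q \<bullet> h q = k" for f h :: surf and k p
    using partials_bilinear(1,2)[OF bounded_bilinear_inner smooth_on_differentiable[OF fh(1) p] smooth_on_differentiable[OF fh(2) p]]
      partials_cong[OF D p, of "\<lambda>q. f q \<bullet> h q" "\<lambda>q. k"] c by (simp_all add: partials_const)
  have frame_eqs: "pu X p = (e p * g1 p) *\<^sub>R Y p + (e p * n1 p) *\<^sub>R l p"
      "pu Y p = - ((e p * g1 p) *\<^sub>R X p)" "pu l p = - ((e p * n1 p) *\<^sub>R X p)"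
      "pv X p = (g p * g2 p) *\<^sub>R Y p" "pv Y p = (g p * n2 p) *\<^sub>R l p - (g p * g2 p) *\<^sub>R X p"
      "pv l p = - ((g p * n2 p) *\<^sub>R Y p)"
    and ev: "pv e p = - g1 p * e p * g p" and gu: "pu g p = g2 p * e p * g p"
    if p: "p \<in> D" for p
  proof -
    note pp = pos[OF p]
    note on = XX[OF p] YY[OF p] XY[OF p] ll[OF p] lX[OF p] lY[OF p]
    have "Y p \<bullet> X p = 0" "X p \<bullet> l p = 0" "Y p \<bullet> l p = 0"
      using on by (simp_all add: inner_commute)
    note on' = on this
    have inv: "nu1_of y p = n1 p" "nu2_of y p = n2 p" "gamma1_of y p = g1 p" "gamma2_of y p = g2 p" "M_fun y p = 0"
      using y p by (auto simp: principal_surface_with_invariants_def)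
    have "pv (E_fun y) p = 2 * e p * pv e p"
      using partials_cong(2)[OF D p, of "E_fun y" "\<lambda>q. e q * e q"] sq
        partials_bilinear(2)[OF bounded_bilinear_mult dif(1) dif(1)] p by simp
    then show ev: "pv e p = - g1 p * e p * g p"
      using inv(3) pp E[OF p] unfolding gamma1_of_def sq[OF p] g_def[symmetric]
      by (simp add: field_simps)
    have "pu (G_fun y) p = 2 * g p * pu g p"
      using partials_cong(1)[OF D p, of "G_fun y" "\<lambda>q. g q * g q"] sq
        partials_bilinear(1)[OF bounded_bilinear_mult dif(2) dif(2)] p by simp
    then show gu: "pu g p = g2 p * e p * g p"
      using inv(4) pp E[OF p] unfolding gamma2_of_def sq[OF p] e_def[symmetric]
      by (simp add: field_simps)
    have yuu: "pu (pu y) p = e p *\<^sub>R pu X p + pu e p *\<^sub>R X p"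
      and yuv: "pv (pu y) p = e p *\<^sub>R pv X p + pv e p *\<^sub>R X p"
      using partials_cong[OF D p, of "pu y" "\<lambda>q. e q *\<^sub>R X q"] yu
        partials_bilinear[OF bounded_bilinear_scaleR dif(1) dif(3)] p by simp_all
    have yvu: "pu (pv y) p = g p *\<^sub>R pu Y p + pu g p *\<^sub>R Y p"
      and yvv: "pv (pv y) p = g p *\<^sub>R pv Y p + pv g p *\<^sub>R Y p"
      using partials_cong[OF D p, of "pv y" "\<lambda>q. g q *\<^sub>R Y q"] yv
        partials_bilinear[OF bounded_bilinear_scaleR dif(2) dif(4)] p by simp_all
    \<comment> \<open>The X and Y components of x_uv = x_vu give the tangential coefficients through
      e_v and g_u. The l component transfers M = 0 from the derivative of X to that of Y.\<close>
    have mixed: "e p *\<^sub>R pv X p + pv e p *\<^sub>R X p = g p *\<^sub>R pu Y p + pu g p *\<^sub>R Y p"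
      using mixed_partials_commute[OF D sm p] yuv yvu by simp
    note cXX = const_partials[OF p sX sX XX] and cYY = const_partials[OF p sY sY YY]
      and cXY = const_partials[OF p sX sY XY] and cll = const_partials[OF p sl sl ll]
      and clX = const_partials[OF p sl sX lX] and clY = const_partials[OF p sl sY lY]
    have X_X: "pu X p \<bullet> X p = 0" "pv X p \<bullet> X p = 0" and Y_Y: "pu Y p \<bullet> Y p = 0" "pv Y p \<bullet> Y p = 0"
      and l_l: "pu l p \<bullet> l p = 0" "pv l p \<bullet> l p = 0"
      using cXX cYY cll by (simp_all add: inner_commute)
    have "g p * (pu Y p \<bullet> X p) = pv e p"
      using arg_cong[OF mixed, of "\<lambda>w. w \<bullet> X p"] X_X on' by (simp add: inner_add_left)
    then have "g p * (pu Y p \<bullet> X p) = g p * (- (e p * g1 p))" by (simp add: ev)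
    then have uYX: "pu Y p \<bullet> X p = - (e p * g1 p)" using pp(4) mult_left_cancel by blast
    have "e p * (pv X p \<bullet> Y p) = pu g p"
      using arg_cong[OF mixed, of "\<lambda>w. w \<bullet> Y p"] Y_Y on' by (simp add: inner_add_left)
    then have "e p * (pv X p \<bullet> Y p) = e p * (g p * g2 p)" by (simp add: gu ac_simps)
    then have vXY: "pv X p \<bullet> Y p = g p * g2 p" using pp(3) mult_left_cancel by blast
    have vXl: "pv X p \<bullet> l p = 0"
      using inv(5) on' pp unfolding M_fun_def nrm[OF p] yuv by (simp add: inner_add_left)
    have uYl: "pu Y p \<bullet> l p = 0"
      using arg_cong[OF mixed, of "\<lambda>w. w \<bullet> l p"] vXl on' pp by (simp add: inner_add_left)
    have uXl: "pu X p \<bullet> l p = e p * n1 p"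
      using inv(1) on' pp unfolding nu1_of_def L_fun_def nrm[OF p] yuu sq[OF p]
      by (simp add: inner_add_left inner_diff_left field_simps)
    have vYl: "pv Y p \<bullet> l p = g p * n2 p"
      using inv(2) on' pp unfolding nu2_of_def N_fun_def nrm[OF p] yvv sq[OF p]
      by (simp add: inner_add_left inner_diff_left field_simps)
    have uXY: "pu X p \<bullet> Y p = e p * g1 p" and vYX: "pv Y p \<bullet> X p = - (g p * g2 p)"
      using cXY uYX vXY by (simp_all add: inner_commute)
    have ulX: "pu l p \<bullet> X p = - (e p * n1 p)" and ulY: "pu l p \<bullet> Y p = 0"
      and vlX: "pv l p \<bullet> X p = 0" and vlY: "pv l p \<bullet> Y p = - (g p * n2 p)"
      using clX clY uXl uYl vXl vYl by (simp_all add: inner_commute)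
    note ex = rotation_frame_expansion[OF on(1-3), folded l_def]
    show "pu X p = (e p * g1 p) *\<^sub>R Y p + (e p * n1 p) *\<^sub>R l p"
      by (subst ex[of "pu X p"]) (simp add: X_X uXY uXl)
    show "pu Y p = - ((e p * g1 p) *\<^sub>R X p)"
      by (subst ex[of "pu Y p"]) (simp add: Y_Y uYX uYl)
    show "pu l p = - ((e p * n1 p) *\<^sub>R X p)"
      by (subst ex[of "pu l p"]) (simp add: l_l ulX ulY)
    show "pv X p = (g p * g2 p) *\<^sub>R Y p"
      by (subst ex[of "pv X p"]) (simp add: X_X vXY vXl)
    show "pv Y p = (g p * n2 p) *\<^sub>R l p - (g p * g2 p) *\<^sub>R X p"
      by (subst ex[of "pv Y p"]) (simp add: Y_Y vYX vYl)
    show "pv l p = - ((g p * n2 p) *\<^sub>R Y p)"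
      by (subst ex[of "pv l p"]) (simp add: l_l vlX vlY)
  qed
  have codazzi: "pv n1 p = g1 p * g p * (n1 p - n2 p)" "pu n2 p = g2 p * e p * (n1 p - n2 p)"
    if p: "p \<in> D" for p
  proof -
    note pp = pos[OF p]
    note on = XX[OF p] YY[OF p] XY[OF p]
    note d = dif[OF p]
    have den: "(\<lambda>q. e q * n1 q) differentiable (at p)" "pv (\<lambda>q. e q * n1 q) p = e p * pv n1 p + pv e p * n1 p"
      and dgn: "(\<lambda>q. g q * n2 q) differentiable (at p)" "pu (\<lambda>q. g q * n2 q) p = g p * pu n2 p + pu g p * n2 p"
      using partials_bilinear[OF bounded_bilinear_mult d(1) d(6)] partials_bilinear[OF bounded_bilinear_mult d(2) d(7)]
      by auto
    have luv: "pv (pu l) p = - ((e p * n1 p) *\<^sub>R pv X p + pv (\<lambda>q. e q * n1 q) p *\<^sub>R X p)"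
      using partials_cong(2)[OF D p, of "pu l" "\<lambda>q. - ((e q * n1 q) *\<^sub>R X q)"] frame_eqs(3)
        partials_linear(2)[OF bounded_linear_minus[OF bounded_linear_ident]
          partials_bilinear(3)[OF bounded_bilinear_scaleR den(1) d(3)]]
        partials_bilinear(2)[OF bounded_bilinear_scaleR den(1) d(3)] by simp
    have lvu: "pu (pv l) p = - ((g p * n2 p) *\<^sub>R pu Y p + pu (\<lambda>q. g q * n2 q) p *\<^sub>R Y p)"
      using partials_cong(1)[OF D p, of "pv l" "\<lambda>q. - ((g q * n2 q) *\<^sub>R Y q)"] frame_eqs(6)
        partials_linear(1)[OF bounded_linear_minus[OF bounded_linear_ident]
          partials_bilinear(3)[OF bounded_bilinear_scaleR dgn(1) d(4)]]
        partials_bilinear(1)[OF bounded_bilinear_scaleR dgn(1) d(4)] by simp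
    have eq: "(e p * n1 p) *\<^sub>R pv X p + pv (\<lambda>q. e q * n1 q) p *\<^sub>R X p
        = (g p * n2 p) *\<^sub>R pu Y p + pu (\<lambda>q. g q * n2 q) p *\<^sub>R Y p"
      using mixed_partials_commute[OF D sl p] unfolding luv lvu by (simp only: neg_equal_iff_equal)
    \<comment> \<open>The X component of l_uv = l_vu. Inserting the formula for e_v leaves a common
      factor e, and cancelling it gives the first Codazzi equation; the Y component and g_u give the
      second.\<close>
    have "pv (\<lambda>q. e q * n1 q) p = - (g p * n2 p * (e p * g1 p))"
      using arg_cong[OF eq, of "\<lambda>w. w \<bullet> X p"] on unfolding frame_eqs(2,4)[OF p]
      by (simp add: inner_add_left inner_diff_left inner_add_right inner_diff_right inner_commute)
    then have "e p * pv n1 p = e p * (g1 p * g p * (n1 p - n2 p))"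
      unfolding den(2) ev[OF p] by (simp add: algebra_simps)
    then show "pv n1 p = g1 p * g p * (n1 p - n2 p)" using pp by simp
    have "e p * n1 p * (g p * g2 p) = pu (\<lambda>q. g q * n2 q) p"
      using arg_cong[OF eq, of "\<lambda>w. w \<bullet> Y p"] on unfolding frame_eqs(2,4)[OF p]
      by (simp add: inner_add_left inner_diff_left inner_add_right inner_diff_right inner_commute)
    then have "g p * pu n2 p = g p * (g2 p * e p * (n1 p - n2 p))"
      unfolding dgn(2) gu[OF p] by (simp add: algebra_simps)
    then show "pu n2 p = g2 p * e p * (n1 p - n2 p)" using pp by simp
  qed
  show ?thesis
  proof (rule that[of X Y l e g])
    fix p assume p: "p \<in> D"
    show "rotation_matrix (vector [X p, Y p, l p] :: real^3^3)"
      unfolding l_def by (rule rotation_frameI[OF XX[OF p] YY[OF p] XY[OF p]])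
    show "moving_frame_at X Y l (e p * g1 p) (e p * n1 p) (g p * g2 p) (g p * n2 p) p"
      unfolding moving_frame_at_def using dif[OF p] frame_eqs[OF p] by blast
  qed (use yu yv codazzi in auto)
qed

section \<open>Uniqueness up to a motion\<close>

lemma surface_unique:
  assumes D: "open D" "convex D"
    and x: "principal_surface_with_invariants D x n1 n2 g1 g2"
    and y: "principal_surface_with_invariants D y n1 n2 g1 g2"
    and n: "smooth_on D n1" "smooth_on D n2" and p0: "p0 \<in> D"
  shows "\<exists>(A :: real^3^3) b. orthogonal_matrix A \<and> det A = 1 \<and> (\<forall>p\<in>D. y p = A *v x p + b)"
proof -
  obtain X Y l e g where 1:
    "\<And>p. p \<in> D \<Longrightarrow> rotation_matrix (vector [X p, Y p, l p] :: real^3^3)"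
    "\<And>p. p \<in> D \<Longrightarrow> pu x p = e p *\<^sub>R X p" "\<And>p. p \<in> D \<Longrightarrow> pv x p = g p *\<^sub>R Y p"
    "\<And>p. p \<in> D \<Longrightarrow> moving_frame_at X Y l (e p * g1 p) (e p * n1 p) (g p * g2 p) (g p * n2 p) p"
    "\<And>p. p \<in> D \<Longrightarrow> pv n1 p = g1 p * g p * (n1 p - n2 p)"
    "\<And>p. p \<in> D \<Longrightarrow> pu n2 p = g2 p * e p * (n1 p - n2 p)"
    by (rule surface_moving_frame[OF D(1) x n]) blast
  obtain X' Y' l' e' g' where 2:
    "\<And>p. p \<in> D \<Longrightarrow> rotation_matrix (vector [X' p, Y' p, l' p] :: real^3^3)"
    "\<And>p. p \<in> D \<Longrightarrow> pu y p = e' p *\<^sub>R X' p" "\<And>p. p \<in> D \<Longrightarrow> pv y p = g' p *\<^sub>R Y' p"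
    "\<And>p. p \<in> D \<Longrightarrow> moving_frame_at X' Y' l' (e' p * g1 p) (e' p * n1 p) (g' p * g2 p) (g' p * n2 p) p"
    "\<And>p. p \<in> D \<Longrightarrow> pv n1 p = g1 p * g' p * (n1 p - n2 p)"
    "\<And>p. p \<in> D \<Longrightarrow> pu n2 p = g2 p * e' p * (n1 p - n2 p)"
    by (rule surface_moving_frame[OF D(1) y n]) blast
  \<comment> \<open>Both surfaces satisfy the same Codazzi equations, and strong regularity makes
    the coefficients of e and g there nonzero.\<close>
  have eg: "e' p = e p" "g' p = g p" if "p \<in> D" for p
  proof -
    have "(n1 p - n2 p) * g1 p * g2 p \<noteq> 0"
      using x that by (auto simp: principal_surface_with_invariants_def)
    then show "e' p = e p" "g' p = g p" using 1(5,6)[OF that] 2(5,6)[OF that] by auto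
  qed
  \<comment> \<open>The rotation at \<open>p\<close> from the frame of \<open>x\<close> to the frame
    of \<open>y\<close>. Its entries are scalar functions whose partials vanish, so it can be
    evaluated at \<open>p0\<close> once and for all.\<close>
  define Q where "Q p = transpose (vector [X' p, Y' p, l' p] :: real^3^3) ** vector [X p, Y p, l p]" for p
  have Q_const: "Q p = Q p0" if p: "p \<in> D" for p
  proof -
    have "Q p $ i $ j = Q p0 $ i $ j" for i j
      unfolding Q_def transpose_frame_mult_entry
    proof (rule constant_of_zero_partials[OF D(2) _ _ _ p p0])
      fix q assume q: "q \<in> D"
      note moving_frames_product_partials[OF 1(4)[OF q] 2(4)[OF q, unfolded eg[OF q]]]
      then show "(\<lambda>q. X' q $ i * X q $ j + Y' q $ i * Y q $ j + l' q $ i * l q $ j) differentiable (at q)"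
        "pu (\<lambda>q. X' q $ i * X q $ j + Y' q $ i * Y q $ j + l' q $ i * l q $ j) q = 0"
        "pv (\<lambda>q. X' q $ i * X q $ j + Y' q $ i * Y q $ j + l' q $ i * l q $ j) q = 0" by blast+
    qed
    then show ?thesis by (simp add: vec_eq_iff)
  qed
  have QX: "Q p0 *v X p = X' p" and QY: "Q p0 *v Y p = Y' p" if p: "p \<in> D" for p
  proof -
    note r = rotation_frameD[OF 1(1)[OF p]]
    have "l p \<bullet> X p = 0" "l p \<bullet> Y p = 0" unfolding r(4) by (simp_all add: dot_cross_self inner_commute)
    moreover have "Q p *v w = (X p \<bullet> w) *\<^sub>R X' p + (Y p \<bullet> w) *\<^sub>R Y' p + (l p \<bullet> w) *\<^sub>R l' p" for w
      unfolding Q_def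
      by (simp add: vec_eq_iff matrix_vector_mult_def transpose_frame_mult_entry sum_3 inner_vec_def algebra_simps)
    ultimately show "Q p0 *v X p = X' p" "Q p0 *v Y p = Y' p"
      unfolding Q_const[OF p, symmetric] using r by (simp_all add: inner_commute)
  qed
  have "orthogonal_matrix (Q p0)" "det (Q p0) = 1"
    using 1(1)[OF p0] 2(1)[OF p0] unfolding Q_def rotation_matrix_def
    by (auto simp: orthogonal_matrix_mul orthogonal_matrix_transpose det_mul)
  moreover have "y p = Q p0 *v x p + (y p0 - Q p0 *v x p0)" if p: "p \<in> D" for p
  proof -
    \<comment> \<open>Its value is the translation part. Its partials vanish because the rotation
      sends e X to e X' and g Y to g Y', that is, the partials of \<open>x\<close> to those of
      \<open>y\<close>.\<close>
    let ?h = "\<lambda>q. y q + - (Q p0 *v x q)"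
    have bl: "bounded_linear (\<lambda>w. - (Q p0 *v w))"
      by (intro bounded_linear_minus matrix_vector_mul_bounded_linear)
    have sm: "smooth_on D x" "smooth_on D y" using x y by (auto simp: principal_surface_with_invariants_def)
    have "?h p = ?h p0"
    proof (rule constant_of_zero_partials[OF D(2) _ _ _ p p0])
      fix q assume q: "q \<in> D"
      note d = smooth_on_differentiable[OF sm(1) q] smooth_on_differentiable[OF sm(2) q]
      note L = partials_linear[OF bl d(1)]
      show "?h differentiable (at q)" by (rule differentiable_add[OF d(2) L(3)])
      show "pu ?h q = 0" "pv ?h q = 0"
        using partials_add[OF d(2) L(3)] L(1,2) 1(2,3)[OF q] 2(2,3)[OF q] eg[OF q] QX[OF q] QY[OF q]
        by (simp_all add: matrix_vector_mult_scaleR)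
    qed
    then show ?thesis by (simp add: algebra_simps)
  qed
  ultimately show ?thesis by blast
qed

section \<open>Existence\<close>

text \<open>Infinitesimal motion of a frame (X, Y, l) together with its base point x: the coefficients a, b, d form
  a skew-symmetric matrix, and c, h are the components of the velocity of x along X and Y. Treating x as a part
  of the unknown lets a single integrability theorem produce the frame and the surface at once.\<close>

fun frame_act :: "real \<times> real \<times> real \<times> real \<times> real \<Rightarrow> (real^3) \<times> (real^3) \<times> (real^3) \<times> (real^3)
    \<Rightarrow> (real^3) \<times> (real^3) \<times> (real^3) \<times> (real^3)" where
  "frame_act (a, b, d, c, h) (X, Y, l, x) =
     (a *\<^sub>R Y + b *\<^sub>R l, d *\<^sub>R l - a *\<^sub>R X, - (b *\<^sub>R X) - d *\<^sub>R Y, c *\<^sub>R X + h *\<^sub>R Y)"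

lemma bounded_bilinear_frame_act: "bounded_bilinear frame_act"
  unfolding bilinear_conv_bounded_bilinear[symmetric] bilinear_def
  by (auto intro!: linearI simp: algebra_simps)

text \<open>The functions e and g, candidates for sqrt E and sqrt G, come from solving the Codazzi
  equations. Clearing the logarithms in 2.1 and the quotients in 2.2 brings the hypotheses into the
  form that compatibility requires; the last conclusion is the Gauss equation (e g1)_v = (g g2)_u +
  e g n1 n2 with the product rules expanded.\<close>

lemma lame_coefficients:
  fixes n1 n2 g1 g2 :: "real \<times> real \<Rightarrow> real"
  assumes D: "open D"
    and smooth: "smooth_on D n1" "smooth_on D n2" "smooth_on D g1" "smooth_on D g2"
    and pos: "\<forall>p\<in>D. n1 p - n2 p > 0 \<and> g1 p * pv n1 p > 0 \<and> g2 p * pu n2 p > 0"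
    and c1: "\<forall>p\<in>D. pu (\<lambda>q. ln (pv n1 q / g1 q)) p = pu n1 p / (n1 p - n2 p)"
    and c2: "\<forall>p\<in>D. pv (\<lambda>q. ln (pu n2 q / g2 q)) p = - pv n2 p / (n1 p - n2 p)"
    and gauss: "\<forall>p\<in>D. (n1 p - n2 p) / 2 * (pv (\<lambda>q. (g1 q)\<^sup>2) p / pv n1 p - pu (\<lambda>q. (g2 q)\<^sup>2) p / pu n2 p)
                 - ((g1 p)\<^sup>2 + (g2 p)\<^sup>2) = n1 p * n2 p"
  obtains e g where "smooth_on D e" "smooth_on D g" "\<And>p. p \<in> D \<Longrightarrow> e p > 0" "\<And>p. p \<in> D \<Longrightarrow> g p > 0"
    "\<And>p. p \<in> D \<Longrightarrow> pv n1 p = g1 p * g p * (n1 p - n2 p)"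
    "\<And>p. p \<in> D \<Longrightarrow> pu n2 p = g2 p * e p * (n1 p - n2 p)"
    "\<And>p. p \<in> D \<Longrightarrow> pv e p = - g1 p * e p * g p" "\<And>p. p \<in> D \<Longrightarrow> pu g p = g2 p * e p * g p"
    "\<And>p. p \<in> D \<Longrightarrow> e p * pv g1 p + pv e p * g1 p = g p * pu g2 p + pu g p * g2 p + e p * g p * n1 p * n2 p"
proof -
  have nz: "n1 p - n2 p \<noteq> 0" "g1 p \<noteq> 0" "g2 p \<noteq> 0" "pv n1 p / g1 p > 0" "pu n2 p / g2 p > 0" if "p \<in> D" for p
  proof -
    have "n1 p - n2 p > 0" "g1 p * pv n1 p > 0" "g2 p * pu n2 p > 0" using pos that by auto
    then show "n1 p - n2 p \<noteq> 0" "g1 p \<noteq> 0" "g2 p \<noteq> 0" "pv n1 p / g1 p > 0" "pu n2 p / g2 p > 0"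
      by (auto simp: zero_less_mult_iff zero_less_divide_iff)
  qed
  \<comment> \<open>\<open>wg\<close> and \<open>we\<close> are the arguments of the two logarithms
    in 2.1, that is, g and e multiplied by n1 - n2.\<close>
  define wg where "wg p = pv n1 p / g1 p" for p
  define we where "we p = pu n2 p / g2 p" for p
  define g where "g p = wg p / (n1 p - n2 p)" for p
  define e where "e p = we p / (n1 p - n2 p)" for p
  have swg: "smooth_on D wg" and swe: "smooth_on D we"
    unfolding wg_def[abs_def] we_def[abs_def]
    by (intro smooth_on_divide D smooth_on_pu smooth_on_pv smooth nz; assumption)+
  have sg: "smooth_on D g" and se: "smooth_on D e"
    unfolding g_def[abs_def] e_def[abs_def]
    by (intro smooth_on_divide smooth_on_diff D swg swe smooth nz; assumption)+
  have gp: "g p > 0" and ep: "e p > 0" if "p \<in> D" for p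
    unfolding g_def e_def wg_def we_def using nz(4,5)[OF that] pos that by (blast intro: divide_pos_pos)+
  have n1v: "pv n1 p = g1 p * g p * (n1 p - n2 p)" and n2u: "pu n2 p = g2 p * e p * (n1 p - n2 p)"
    if "p \<in> D" for p
    using nz[OF that] by (auto simp: g_def e_def wg_def we_def)
  have ev: "pv e p = - g1 p * e p * g p" if p: "p \<in> D" for p
  proof -
    note d = smooth[THEN smooth_on_differentiable, OF p] swe[THEN smooth_on_differentiable, OF p]
      se[THEN smooth_on_differentiable, OF p]
    have w: "we p > 0" using nz[OF p] by (simp add: we_def)
    have "(ln has_real_derivative inverse (we p)) (at (we p))"
      using w by (auto intro!: derivative_eq_intros simp: divide_inverse)
    from partials_chain(2)[OF this d(5)] c2[rule_format, OF p, folded we_def] w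
    have wv: "pv we p = - we p * pv n2 p / (n1 p - n2 p)"
      by (simp add: field_simps)
    have dn: "(\<lambda>q. n1 q - n2 q) differentiable (at p)" "pv (\<lambda>q. n1 q - n2 q) p = pv n1 p - pv n2 p"
      using d partials_add(2)[of n1 p "\<lambda>q. - n2 q"] partials_linear[OF bounded_linear_minus[OF bounded_linear_ident] d(2)]
      by auto
    \<comment> \<open>Two expressions for one derivative, by the product rule here and by 2.1 below:
      the terms with \<open>pv n2 p\<close> cancel, and Codazzi turns \<open>pv n1 p\<close> into a
      multiple of n1 - n2, which divides out.\<close>
    have "pv we p = e p * pv (\<lambda>q. n1 q - n2 q) p + pv e p * (n1 p - n2 p)"
      using partials_cong(2)[OF D p, of we "\<lambda>q. e q * (n1 q - n2 q)"] nz
        partials_bilinear(2)[OF bounded_bilinear_mult d(6) dn(1)] by (simp add: e_def)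
    moreover have "pv we p = - e p * pv n2 p" using nz[OF p] wv by (simp add: e_def)
    ultimately have "pv e p * (n1 p - n2 p) = - g1 p * e p * g p * (n1 p - n2 p)"
      unfolding dn(2) n1v[OF p] by (simp add: algebra_simps)
    then show ?thesis using nz(1)[OF p] mult_right_cancel by blast
  qed
  have gu: "pu g p = g2 p * e p * g p" if p: "p \<in> D" for p
  proof -
    note d = smooth[THEN smooth_on_differentiable, OF p] swg[THEN smooth_on_differentiable, OF p]
      sg[THEN smooth_on_differentiable, OF p]
    have w: "wg p > 0" using nz[OF p] by (simp add: wg_def)
    have "(ln has_real_derivative inverse (wg p)) (at (wg p))"
      using w by (auto intro!: derivative_eq_intros simp: divide_inverse)
    from partials_chain(1)[OF this d(5)] c1[rule_format, OF p, folded wg_def] w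
    have wv: "pu wg p = wg p * pu n1 p / (n1 p - n2 p)"
      by (simp add: field_simps)
    have dn: "(\<lambda>q. n1 q - n2 q) differentiable (at p)" "pu (\<lambda>q. n1 q - n2 q) p = pu n1 p - pu n2 p"
      using d partials_add(1)[of n1 p "\<lambda>q. - n2 q"] partials_linear[OF bounded_linear_minus[OF bounded_linear_ident] d(2)]
      by auto
    have "pu wg p = g p * pu (\<lambda>q. n1 q - n2 q) p + pu g p * (n1 p - n2 p)"
      using partials_cong(1)[OF D p, of wg "\<lambda>q. g q * (n1 q - n2 q)"] nz
        partials_bilinear(1)[OF bounded_bilinear_mult d(6) dn(1)] by (simp add: g_def)
    moreover have "pu wg p = g p * pu n1 p" using nz[OF p] wv by (simp add: g_def)
    ultimately have "pu g p * (n1 p - n2 p) = g2 p * e p * g p * (n1 p - n2 p)"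
      unfolding dn(2) n2u[OF p] by (simp add: algebra_simps)
    then show ?thesis using nz(1)[OF p] mult_right_cancel by blast
  qed
  have "e p * pv g1 p + pv e p * g1 p = g p * pu g2 p + pu g p * g2 p + e p * g p * n1 p * n2 p" if p: "p \<in> D" for p
  proof -
    note d = smooth[THEN smooth_on_differentiable, OF p]
    have "pv (\<lambda>q. (g1 q)\<^sup>2) p = 2 * g1 p * pv g1 p" "pu (\<lambda>q. (g2 q)\<^sup>2) p = 2 * g2 p * pu g2 p"
      unfolding power2_eq_square
      using partials_bilinear(2)[OF bounded_bilinear_mult d(3) d(3)] partials_bilinear(1)[OF bounded_bilinear_mult d(4) d(4)]
      by auto
    with gauss[rule_format, OF p]
    have "(n1 p - n2 p) / 2 * (2 * g1 p * pv g1 p / (g1 p * g p * (n1 p - n2 p)) - 2 * g2 p * pu g2 p / (g2 p * e p * (n1 p - n2 p)))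
        - ((g1 p)\<^sup>2 + (g2 p)\<^sup>2) = n1 p * n2 p"
      unfolding n1v[OF p] n2u[OF p] by simp
    moreover have "(n1 p - n2 p) / 2 * (2 * g1 p * pv g1 p / (g1 p * g p * (n1 p - n2 p)) - 2 * g2 p * pu g2 p / (g2 p * e p * (n1 p - n2 p)))
       = pv g1 p / g p - pu g2 p / e p"
    proof -
      have "k / 2 * (2 * a * x / (a * r * k) - 2 * b * y / (b * s * k)) = x / r - y / s"
        if "k \<noteq> 0" "a \<noteq> 0" "b \<noteq> 0" "r > 0" "s > 0" for k a b r s x y :: real
        using that by (simp add: field_simps)
      from this[OF nz(1-3)[OF p] gp[OF p] ep[OF p]] show ?thesis .
    qed
    ultimately have "pv g1 p / g p - pu g2 p / e p = (g1 p)\<^sup>2 + (g2 p)\<^sup>2 + n1 p * n2 p" by linarith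
    then have "e p * g p * (pv g1 p / g p - pu g2 p / e p) = e p * g p * ((g1 p)\<^sup>2 + (g2 p)\<^sup>2 + n1 p * n2 p)" by simp
    moreover have "e p * g p * (pv g1 p / g p - pu g2 p / e p) = e p * pv g1 p - g p * pu g2 p"
      using gp[OF p] ep[OF p] by (simp add: field_simps)
    ultimately show ?thesis
      unfolding ev[OF p] gu[OF p] by (simp add: algebra_simps power2_eq_square)
  qed
  then show ?thesis using that[of e g] sg se gp ep n1v n2u ev gu by blast
qed

text \<open>Converse of \<open>surface_moving_frame\<close>. The second fundamental form is read off
  from the frame equations, whereas the geodesic curvatures come from e_v and g_u: with E = e^2 and
  sqrt G = g, the definition of gamma1 becomes - e_v / (e g).\<close>

lemma surface_of_moving_frame:
  assumes D: "open D" and smooth: "smooth_on D x" "smooth_on D e" "smooth_on D g"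
    and pos: "\<And>p. p \<in> D \<Longrightarrow> e p > 0" "\<And>p. p \<in> D \<Longrightarrow> g p > 0"
    and xu: "\<And>p. p \<in> D \<Longrightarrow> pu x p = e p *\<^sub>R X p" and xv: "\<And>p. p \<in> D \<Longrightarrow> pv x p = g p *\<^sub>R Y p"
    and rot: "\<And>p. p \<in> D \<Longrightarrow> rotation_matrix (vector [X p, Y p, l p] :: real^3^3)"
    and frame: "\<And>p. p \<in> D \<Longrightarrow> moving_frame_at X Y l (e p * g1 p) (e p * n1 p) (g p * g2 p) (g p * n2 p) p"
    and ev: "\<And>p. p \<in> D \<Longrightarrow> pv e p = - g1 p * e p * g p" and gu: "\<And>p. p \<in> D \<Longrightarrow> pu g p = g2 p * e p * g p"
    and n: "\<And>p. p \<in> D \<Longrightarrow> n1 p - n2 p > 0" "\<And>p. p \<in> D \<Longrightarrow> g1 p * g2 p \<noteq> 0"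
  shows "principal_surface_with_invariants D x n1 n2 g1 g2"
proof -
  have "cross3 (pu x p) (pv x p) \<noteq> 0 \<and> F_fun x p = 0 \<and> M_fun x p = 0 \<and>
      nu1_of x p = n1 p \<and> nu2_of x p = n2 p \<and> gamma1_of x p = g1 p \<and> gamma2_of x p = g2 p"
    if p: "p \<in> D" for p
  proof -
    note pp = pos[OF p]
    note r = rotation_frameD[OF rot]
    have l: "X p \<bullet> l p = 0" "Y p \<bullet> l p = 0" "l p \<bullet> l p = 1" "l p \<noteq> 0"
      using r(1-3)[OF p] unfolding r(4)[OF p] by (auto simp: dot_cross dot_cross_self inner_commute
        simp flip: inner_eq_zero_iff[of "cross3 _ _"])
    have E: "E_fun x q = e q * e q" and G: "G_fun x q = g q * g q" if "q \<in> D" for q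
      using r(1,2)[OF that] that by (simp_all add: E_fun_def G_fun_def xu xv)
    have cr: "cross3 (pu x p) (pv x p) = (e p * g p) *\<^sub>R l p"
      using p by (simp add: xu xv r(4) cross_mult_left cross_mult_right)
    moreover have "norm (l p) = 1" using l by (simp add: norm_eq_1)
    ultimately have nrm: "normal x p = l p" using pp by (simp add: normal_def)
    note d = smooth(2,3)[THEN smooth_on_differentiable, OF p]
    have fr: "X differentiable (at p)" "Y differentiable (at p)"
      "pu X p = (e p * g1 p) *\<^sub>R Y p + (e p * n1 p) *\<^sub>R l p" "pv X p = (g p * g2 p) *\<^sub>R Y p"
      "pv Y p = (g p * n2 p) *\<^sub>R l p - (g p * g2 p) *\<^sub>R X p"
      using frame[OF p] by (auto simp: moving_frame_at_def)
    have "pu (pu x) p = e p *\<^sub>R pu X p + pu e p *\<^sub>R X p" "pv (pu x) p = e p *\<^sub>R pv X p + pv e p *\<^sub>R X p"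
      using partials_cong[OF D p, of "pu x" "\<lambda>q. e q *\<^sub>R X q"] xu
        partials_bilinear[OF bounded_bilinear_scaleR d(1) fr(1)] by simp_all
    moreover have "pv (pv x) p = g p *\<^sub>R pv Y p + pv g p *\<^sub>R Y p"
      using partials_cong[OF D p, of "pv x" "\<lambda>q. g q *\<^sub>R Y q"] xv
        partials_bilinear[OF bounded_bilinear_scaleR d(2) fr(2)] by simp
    ultimately have "L_fun x p = e p * (e p * n1 p)" "M_fun x p = 0" "N_fun x p = g p * (g p * n2 p)"
      using l by (simp_all add: L_fun_def M_fun_def N_fun_def nrm fr inner_add_left inner_diff_left)
    moreover have "pv (E_fun x) p = 2 * e p * pv e p" "pu (G_fun x) p = 2 * g p * pu g p"
      using partials_cong(2)[OF D p, of "E_fun x" "\<lambda>q. e q * e q"] E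
        partials_bilinear(2)[OF bounded_bilinear_mult d(1) d(1)]
        partials_cong(1)[OF D p, of "G_fun x" "\<lambda>q. g q * g q"] G
        partials_bilinear(1)[OF bounded_bilinear_mult d(2) d(2)] by simp_all
    ultimately show ?thesis
      using cr l pp r(3)[OF p] p
      by (simp add: F_fun_def xu xv nu1_of_def nu2_of_def gamma1_of_def gamma2_of_def E G ev gu field_simps)
  qed
  then show ?thesis
    using smooth(1) n unfolding principal_surface_with_invariants_def
    by (simp add: mult.assoc less_imp_neq[symmetric])
qed

lemma surface_exists:
  fixes n1 n2 g1 g2 :: "real \<times> real \<Rightarrow> real"
  assumes D: "open D" and uv0: "(u0, v0) \<in> D"
    and smooth: "smooth_on D n1" "smooth_on D n2" "smooth_on D g1" "smooth_on D g2"
      "smooth_on D e" "smooth_on D g"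
    and pos: "\<And>p. p \<in> D \<Longrightarrow> e p > 0" "\<And>p. p \<in> D \<Longrightarrow> g p > 0"
    and n: "\<And>p. p \<in> D \<Longrightarrow> n1 p - n2 p > 0" "\<And>p. p \<in> D \<Longrightarrow> g1 p * g2 p \<noteq> 0"
    and n1v: "\<And>p. p \<in> D \<Longrightarrow> pv n1 p = g1 p * g p * (n1 p - n2 p)"
    and n2u: "\<And>p. p \<in> D \<Longrightarrow> pu n2 p = g2 p * e p * (n1 p - n2 p)"
    and ev: "\<And>p. p \<in> D \<Longrightarrow> pv e p = - g1 p * e p * g p" and gu: "\<And>p. p \<in> D \<Longrightarrow> pu g p = g2 p * e p * g p"
    and gauss: "\<And>p. p \<in> D \<Longrightarrow>
      e p * pv g1 p + pv e p * g1 p = g p * pu g2 p + pu g p * g2 p + e p * g p * n1 p * n2 p"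
  obtains a b c d x where "a < u0" "u0 < b" "c < v0" "v0 < d" "{a<..<b} \<times> {c<..<d} \<subseteq> D"
    "principal_surface_with_invariants ({a<..<b} \<times> {c<..<d}) x n1 n2 g1 g2"
proof -
  \<comment> \<open>The third slot is 0 in \<open>A\<close> and the second is 0 in \<open>B\<close>
    because M = 0; the last two slots say that x moves along X in the direction u and along Y in the
    direction v.\<close>
  define A where "A p = (e p * g1 p, e p * n1 p, 0::real, e p, 0::real)" for p
  define B where "B p = (g p * g2 p, 0::real, g p * n2 p, 0::real, g p)" for p
  have sA: "smooth_on D A" and sB: "smooth_on D B"
    unfolding A_def[abs_def] B_def[abs_def]
    by (intro smooth_on_Pair smooth_on_mult smooth_on_const D smooth)+
  have pA: "pv A p = (pv (\<lambda>q. e q * g1 q) p, pv (\<lambda>q. e q * n1 q) p, 0, pv e p, 0)"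
    and pB: "pu B p = (pu (\<lambda>q. g q * g2 q) p, 0, pu (\<lambda>q. g q * n2 q) p, 0, pu g p)" if p: "p \<in> D" for p
    unfolding A_def[abs_def] B_def[abs_def]
    by (subst partials_Pair, (intro smooth_on_differentiable[OF _ p] smooth_on_Pair smooth_on_mult smooth_on_const D smooth)+,
        simp add: partials_const)+
  have compat: "frame_act (pv A p) s + frame_act (A p) (frame_act (B p) s)
      = frame_act (pu B p) s + frame_act (B p) (frame_act (A p) s)" if p: "p \<in> D" for p s
  proof -
    note d = smooth[THEN smooth_on_differentiable, OF p]
    \<comment> \<open>Compatibility is checked slot by slot: the rotation of X and Y gives the Gauss
      equation, the two rotations involving l give the Codazzi equations 2 and 3, and the position
      gives e_v and g_u.\<close>
    have 1: "pv (\<lambda>q. e q * g1 q) p = pu (\<lambda>q. g q * g2 q) p + e p * g p * n1 p * n2 p"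
      using gauss[OF p] partials_bilinear(2)[OF bounded_bilinear_mult d(5) d(3)]
        partials_bilinear(1)[OF bounded_bilinear_mult d(6) d(4)] by simp
    have 2: "pv (\<lambda>q. e q * n1 q) p = - e p * g p * g1 p * n2 p"
      using partials_bilinear(2)[OF bounded_bilinear_mult d(5) d(1)] ev[OF p] n1v[OF p]
      by (simp add: algebra_simps)
    have 3: "pu (\<lambda>q. g q * n2 q) p = e p * g p * g2 p * n1 p"
      using partials_bilinear(1)[OF bounded_bilinear_mult d(6) d(2)] gu[OF p] n2u[OF p]
      by (simp add: algebra_simps)
    obtain X Y l x where s: "s = (X, Y, l, x)" by (cases s) auto
    show ?thesis
      unfolding s pA[OF p] pB[OF p] A_def B_def frame_act.simps 1 2 3 ev[OF p] gu[OF p]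
      by (simp add: algebra_simps)
  qed
  \<comment> \<open>The initial frame is the standard basis, orthonormal and right-handed, with the
    base point at the origin.\<close>
  obtain a b c d \<Phi> where ab: "a < u0" "u0 < b" "c < v0" "v0 < d" "{a..b} \<times> {c..d} \<subseteq> D"
    and \<Phi>: "continuous_on ({a..b} \<times> {c..d}) \<Phi>"
      "\<Phi> (a, c) = (axis 1 1, axis 2 1, axis 3 1, 0)" "smooth_on ({a<..<b} \<times> {c<..<d}) \<Phi>"
      "\<And>p. p \<in> {a<..<b} \<times> {c<..<d} \<Longrightarrow> pu \<Phi> p = frame_act (A p) (\<Phi> p)"
      "\<And>p. p \<in> {a<..<b} \<times> {c<..<d} \<Longrightarrow> pv \<Phi> p = frame_act (B p) (\<Phi> p)"
    by (rule frobenius_local[OF bounded_bilinear_frame_act D uv0 sA sB compat]) blast+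
  let ?Q = "{a<..<b} \<times> {c<..<d}"
  have lt: "a < b" "c < d" using ab by auto
  have "?Q \<subseteq> {a..b} \<times> {c..d}" by auto
  then have Q: "open ?Q" "?Q \<subseteq> D" using ab(5) by (auto intro!: open_Times)
  define X where "X p = fst (\<Phi> p)" for p
  define Y where "Y p = fst (snd (\<Phi> p))" for p
  define l where "l p = fst (snd (snd (\<Phi> p)))" for p
  define x where "x p = snd (snd (snd (\<Phi> p)))" for p
  note XYlx = X_def Y_def l_def x_def
  have \<Phi>_eq: "\<Phi> p = (X p, Y p, l p, x p)" for p by (simp add: XYlx)
  have bl: "bounded_linear (\<lambda>s. fst s :: real^3)" "bounded_linear (\<lambda>s. fst (snd s) :: real^3)"
    "bounded_linear (\<lambda>s. fst (snd (snd s)) :: real^3)" "bounded_linear (\<lambda>s. snd (snd (snd s)) :: real^3)"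
    by (intro bounded_linear_intros)+
  have frame: "moving_frame_at X Y l (e p * g1 p) (e p * n1 p) (g p * g2 p) (g p * n2 p) p"
    and xu: "pu x p = e p *\<^sub>R X p" and xv: "pv x p = g p *\<^sub>R Y p" if p: "p \<in> ?Q" for p
  proof -
    note d = smooth_on_differentiable[OF \<Phi>(3) p]
    note PX = partials_linear[OF bl(1) d, folded X_def] and PY = partials_linear[OF bl(2) d, folded Y_def]
      and Pl = partials_linear[OF bl(3) d, folded l_def] and Px = partials_linear[OF bl(4) d, folded x_def]
    show "moving_frame_at X Y l (e p * g1 p) (e p * n1 p) (g p * g2 p) (g p * n2 p) p"
      unfolding moving_frame_at_def
      using PX PY Pl by (simp add: \<Phi>(4,5)[OF p] A_def B_def \<Phi>_eq)
    show "pu x p = e p *\<^sub>R X p" "pv x p = g p *\<^sub>R Y p"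
      using Px by (simp_all add: \<Phi>(4,5)[OF p] A_def B_def \<Phi>_eq)
  qed
  have cont: "continuous_on ({a..b} \<times> {c..d}) X" "continuous_on ({a..b} \<times> {c..d}) Y"
    "continuous_on ({a..b} \<times> {c..d}) l"
    unfolding XYlx by (intro continuous_intros \<Phi>(1))+
  have init: "X (a, c) = axis 1 1" "Y (a, c) = axis 2 1" "l (a, c) = axis 3 1"
    by (simp_all add: XYlx \<Phi>(2))
  have rot: "rotation_matrix (vector [X p, Y p, l p] :: real^3^3)" if p: "p \<in> ?Q" for p
  proof -
    \<comment> \<open>The frame is compared with itself: transpose of M times M is constant, and it
      is the identity at the corner.\<close>
    have "X p $ i * X p $ j + Y p $ i * Y p $ j + l p $ i * l p $ j
        = X (a, c) $ i * X (a, c) $ j + Y (a, c) $ i * Y (a, c) $ j + l (a, c) $ i * l (a, c) $ j" for i j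
      by (rule constant_on_rectangle[OF lt _ _ _ _ p])
         (intro continuous_intros cont moving_frames_product_partials[OF frame frame]; assumption)+
    then have "transpose (vector [X p, Y p, l p] :: real^3^3) ** vector [X p, Y p, l p] = mat 1"
      unfolding vec_eq_iff transpose_frame_mult_entry init
      by (simp add: forall_3 axis_def mat_def)
    moreover have "X p \<bullet> cross3 (Y p) (l p) = X (a, c) \<bullet> cross3 (Y (a, c)) (l (a, c))"
      by (rule constant_on_rectangle[OF lt _ _ _ _ p])
         (intro continuous_intros continuous_on_cross cont moving_frame_triple_product_partials[OF frame]; assumption)+
    then have "det (vector [X p, Y p, l p] :: real^3^3) = 1"
      unfolding init by (simp add: dot_cross_det[symmetric] cross_basis inner_axis_axis)
    ultimately show ?thesis
      unfolding rotation_matrix_def orthogonal_matrix_def by (metis matrix_left_right_inverse)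
  qed
  have "principal_surface_with_invariants ?Q x n1 n2 g1 g2"
  proof (rule surface_of_moving_frame[OF Q(1) _ _ _ _ _ xu xv rot frame])
    show "smooth_on ?Q x" unfolding x_def[abs_def] by (rule smooth_on_linear[OF bl(4) Q(1) \<Phi>(3)])
    show "smooth_on ?Q e" "smooth_on ?Q g" using smooth Q(2) smooth_on_subset by blast+
  qed (use Q(2) pos ev gu n in blast)+
  then show ?thesis using that[OF ab(1-4) Q(2)] by blast
qed

theorem theorem3p2:
  fixes D :: "(real \<times> real) set"
    and n1 n2 g1 g2 :: "real \<times> real \<Rightarrow> real"
  assumes "open D"
    and "smooth_on D n1" "smooth_on D n2" "smooth_on D g1" "smooth_on D g2"
    and "\<forall>p\<in>D. n1 p - n2 p > 0 \<and> g1 p * pv n1 p > 0 \<and> g2 p * pu n2 p > 0"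
    and "\<forall>p\<in>D. pu (\<lambda>q. ln (pv n1 q / g1 q)) p = pu n1 p / (n1 p - n2 p)"
    and "\<forall>p\<in>D. pv (\<lambda>q. ln (pu n2 q / g2 q)) p = - pv n2 p / (n1 p - n2 p)"
    and "\<forall>p\<in>D. (n1 p - n2 p) / 2 * (pv (\<lambda>q. (g1 q)\<^sup>2) p / pv n1 p - pu (\<lambda>q. (g2 q)\<^sup>2) p / pu n2 p)
                 - ((g1 p)\<^sup>2 + (g2 p)\<^sup>2) = n1 p * n2 p"
    and "(u0, v0) \<in> D"
  shows "\<exists>D0 x. open D0 \<and> connected D0 \<and> (u0, v0) \<in> D0 \<and> D0 \<subseteq> D \<and>
           principal_surface_with_invariants D0 x n1 n2 g1 g2 \<and>
           (\<forall>y. principal_surface_with_invariants D0 y n1 n2 g1 g2 \<longrightarrow>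
                (\<exists>(A :: real^3^3) (b :: real^3). orthogonal_matrix A \<and> det A = 1 \<and>
                    (\<forall>p\<in>D0. y p = A *v x p + b)))"
proof -
  obtain e g where eg: "smooth_on D e" "smooth_on D g" "\<And>p. p \<in> D \<Longrightarrow> e p > 0" "\<And>p. p \<in> D \<Longrightarrow> g p > 0"
    "\<And>p. p \<in> D \<Longrightarrow> pv n1 p = g1 p * g p * (n1 p - n2 p)"
    "\<And>p. p \<in> D \<Longrightarrow> pu n2 p = g2 p * e p * (n1 p - n2 p)"
    "\<And>p. p \<in> D \<Longrightarrow> pv e p = - g1 p * e p * g p" "\<And>p. p \<in> D \<Longrightarrow> pu g p = g2 p * e p * g p"
    "\<And>p. p \<in> D \<Longrightarrow> e p * pv g1 p + pv e p * g1 p = g p * pu g2 p + pu g p * g2 p + e p * g p * n1 p * n2 p"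
    by (rule lame_coefficients[OF assms(1-9)]) blast
  have n: "n1 p - n2 p > 0" "g1 p * g2 p \<noteq> 0" if "p \<in> D" for p
    using assms(6) that by auto
  obtain a b c d x where 1: "a < u0" "u0 < b" "c < v0" "v0 < d" "{a<..<b} \<times> {c<..<d} \<subseteq> D"
    and x: "principal_surface_with_invariants ({a<..<b} \<times> {c<..<d}) x n1 n2 g1 g2"
    by (rule surface_exists[OF assms(1,10,2-5) eg(1-4) n eg(5-9)])
  let ?Q = "{a<..<b} \<times> {c<..<d}"
  \<comment> \<open>Convexity serves \<open>surface_unique\<close> and also yields the connectedness
    asked for in the statement.\<close>
  have Q: "open ?Q" "convex ?Q" "(u0, v0) \<in> ?Q"
    using 1 by (auto intro!: open_Times convex_Times)
  have "\<exists>(A :: real^3^3) b. orthogonal_matrix A \<and> det A = 1 \<and> (\<forall>p\<in>?Q. y p = A *v x p + b)"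
    if "principal_surface_with_invariants ?Q y n1 n2 g1 g2" for y
    by (rule surface_unique[OF Q(1,2) x that _ _ Q(3)]) (use assms(2,3) 1(5) smooth_on_subset in blast)+
  then show ?thesis
    using Q 1(5) x convex_connected[OF Q(2)] by blast
qed

end
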